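(* The following logarithmic asymptotics hold as $t\to\infty$: (i) If $\mu(t)=b\log t-\log a$ for all large $t$, with $b\in(0,1/\ell)$ and $a>0$, then \[ \mathbb{P}(D>t)\approx_{\log}\exp\Bigl\{-\frac{b\,a^{\ell}}{1-b\ell}\,t^{1-b\ell}\log t\Bigr\}. \] (ii) If $\ell=1$ and $\mu(t)=\log t-b\log\log t-\log a$ for all large $t$, with $a>0$ and $b>-2$, then \[ \mathbb{P}(D>t)\approx_{\log}\exp\Bigl\{-\frac{a}{2+b}\,(\log t)^{2+b}\Bigr\}. \] (iii) If $\ell=1$ and $\mu(t)=\log t+2\log\log t-\log a$ for all large $t$, with $a>0$, then \[ \mathbb{P}(D>t)\approx_{\log}(\log t)^{-a}. \]
   Context: Let $\ell>0$ be fixed. $\mathcal N$ is an inhomogeneous Poisson point process on $(0,\infty)$ with rate function $\mu(t)$, i.e. with intensity measure $\mu(t)\,\mathrm{d}t$; write $M(a,b)=\int_a^b\mu(t)\,\mathrm{d}t$. It is assumed that $M(0,t)<\infty$ for every finite $t$ and that $\mu(t)>0$ for Lebesgue-almost all $t\ge 0$. Let $0<T_1<T_2<\cdots$ be the epochs (points) of $\mathcal N$, with $T_0=0$ by convention; if $\mathcal N$ has only finitely many points, say $n$ of them, then $T_{n+1}=\infty$. Define $D=\min\{T_n:\ n\ge 0,\ T_{n+1}-T_n\ge \ell\}$, with $D=\infty$ if there is no such $n$. The relation $f(t)\approx_{\log} g(t)$ means $\log f(t)/\log g(t)\to 1$ as $t\to\infty$. *)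

theory Defs
  imports "HOL-Probability.Probability"
begin

definition intensity_measure :: "(real \<Rightarrow> real) \<Rightarrow> real measure" where
  "intensity_measure \<mu> = density lborel (\<lambda>t. indicator {0<..} t * ennreal (\<mu> t))"

text \<open>
  A point process on the positive half-line is given by its random set of points. Nothing is lost
  by using sets instead of counting measures: the intensity is absolutely continuous, so the process
  is simple. Only sets of finite intensity are used, because \<^const>\<open>card\<close> is meaningful only
  for finite sets. Together with the local finiteness of the point set and of the intensity, this
  determines the law of the process. The independence clause is about sequences of sets; finite
  families are covered by padding with the empty set. The Poisson weights are written out because
  \<^const>\<open>poisson_pmf\<close> is unspecified at parameter \<open>0\<close>, which occurs for null sets.
\<close>

definition poisson_point_process ::
    "'w measure \<Rightarrow> ('w \<Rightarrow> real set) \<Rightarrow> (real \<Rightarrow> real) \<Rightarrow> bool" where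
  "poisson_point_process P N \<mu> \<longleftrightarrow>
     prob_space P \<and>
     set_borel_measurable borel {0<..} \<mu> \<and> (\<forall>t>0. 0 \<le> \<mu> t) \<and>
     (\<forall>\<omega>\<in>space P. N \<omega> \<subseteq> {0<..} \<and> (\<forall>t. finite (N \<omega> \<inter> {..t}))) \<and>
     (\<forall>B\<in>sets borel. B \<subseteq> {0<..} \<longrightarrow> emeasure (intensity_measure \<mu>) B < \<infinity> \<longrightarrow>
        (\<lambda>\<omega>. card (N \<omega> \<inter> B)) \<in> measurable P (count_space UNIV) \<and>
        (\<forall>k. measure P {\<omega> \<in> space P. card (N \<omega> \<inter> B) = k} =
          measure (intensity_measure \<mu>) B ^ k / fact k * exp (- measure (intensity_measure \<mu>) B))) \<and>
     (\<forall>B :: nat \<Rightarrow> real set.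
        (\<forall>i. B i \<in> sets borel \<and> B i \<subseteq> {0<..} \<and> emeasure (intensity_measure \<mu>) (B i) < \<infinity>) \<longrightarrow>
        disjoint_family B \<longrightarrow>
        prob_space.indep_vars P (\<lambda>_. count_space UNIV) (\<lambda>i \<omega>. card (N \<omega> \<inter> B i)) UNIV)"

text \<open>
  For a locally finite set \<open>S\<close> of positive reals, \<open>epoch S n\<close> is its \<open>n\<close>-th smallest point,
  with \<open>epoch S 0 = 0\<close>. If \<open>S\<close> has only \<open>n\<close> points, the infimum is over the empty
  set and all epochs from index \<open>n + 1\<close> on are \<open>\<infinity>\<close>.
\<close>

primrec epoch :: "real set \<Rightarrow> nat \<Rightarrow> ereal" where
  "epoch S 0 = 0"
| "epoch S (Suc n) = Inf (ereal ` {s \<in> S. epoch S n < ereal s})"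

text \<open>
  The condition that \<open>epoch S n\<close> is finite avoids the difference \<open>\<infinity> - \<infinity>\<close>. The epochs are
  increasing, so the infimum is attained at the first admissible index if there is one, and is
  \<open>\<infinity>\<close> otherwise.
\<close>

definition first_gap :: "real \<Rightarrow> real set \<Rightarrow> ereal" where
  "first_gap l S =
     Inf {epoch S n | n. epoch S n < \<infinity> \<and> epoch S (Suc n) - epoch S n \<ge> ereal l}"

definition log_asymp_equiv :: "(real \<Rightarrow> real) \<Rightarrow> (real \<Rightarrow> real) \<Rightarrow> bool"
    (infix \<open>\<approx>\<^bsub>log\<^esub>\<close> 50) where
  "f \<approx>\<^bsub>log\<^esub> g \<longleftrightarrow> ((\<lambda>t. ln (f t) / ln (g t)) \<longlongrightarrow> 1) at_top"

end

theory Submission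
  imports Defs "HOL-Real_Asymp.Real_Asymp"
begin

text \<open>
  Every point \<open>s\<close> of the process starts a gap of length at least \<open>l\<close> with probability
  \<open>exp (- M(s, s + l))\<close>, so gaps of that length are born at rate \<open>\<mu>(s) exp (- M(s, s + l))\<close>. If
  \<open>\<mu>\<close> varies slowly this is close to \<open>\<mu>(s) exp (- l \<mu>(s))\<close>. Long gaps are rare at late times
  and distant ones are independent, so \<open>- ln P(D > t)\<close> should be asymptotic to a primitive \<open>G\<close>
  of that rate as soon as \<open>G\<close> is unbounded. This is the theorem \<open>ln_survive_asymp\<close> of the locale
  \<open>slow_intensity\<close>, and the three cases of the corollary are instances, where \<open>G\<close> is elementary.
  Only the increments of \<open>G\<close> enter, so no integral is ever computed: both estimates are telescoping
  sums over consecutive blocks.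
  
  \<^emph>\<open>Independence.\<close> The event \<open>D > t\<close> and the existence of a gap starting in a block are functions of
  the events that a set contains no point. These void events are closed under intersection, and their
  probabilities \<open>exp (- mass B)\<close> multiply over disjoint sets. The generated \<open>\<sigma>\<close>-algebras are therefore
  independent over disjoint regions (\<open>prob_history_Int\<close>). That a gap event lies in such a
  \<open>\<sigma>\<close>-algebra follows from a description by grids of increasing fineness
  (\<open>gap_start_iff_grid\<close>).
  
  \<^emph>\<open>One block.\<close> The probability that a gap starts in a block is at most the expected number
  of such gaps, which the grid bounds by \<open>prob_gap_in_le\<close>. Conversely, Bonferroni's inequality bounds
  it from below by the expected number minus the number of pairs (\<open>prob_gap_in_ge\<close>). Pairs cost
  the square of \<open>exp (- l \<mu>)\<close>, so they are negligible.
  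
  \<^emph>\<open>Upper bound.\<close> Blocks of large length \<open>L\<close>, separated by buffers of length \<open>l\<close>, carry independent
  gap events (\<open>survive_le_exp\<close>). Ignoring the buffers costs a factor \<open>L / (l + L)\<close> in the exponent,
  and this factor can be made as close to \<open>1\<close> as desired.
  
  \<^emph>\<open>Lower bound.\<close> If \<open>D > t\<close> but \<open>D \<le> t + l\<close>, then a gap starts in \<open>(t, t + l]\<close>, and this is independent
  of \<open>D > t - l\<close>. Hence \<open>f(t) = P(D > t)\<close> obeys \<open>f(t + l) \<ge> f(t) - p(t) f(t - l)\<close>, where \<open>p(t)\<close>
  is the probability of the gap event. Once the ratio \<open>f(t) / f(t - l)\<close> is close to \<open>1\<close> and
  \<open>p\<close> is small, the ratio stays close to \<open>1\<close>, and the recursion gives \<open>f(t + l) \<ge> f(t) (1 - (1 + \<epsilon>) p(t))\<close>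
  (\<open>delayed_recursion_lower_bound\<close>). To start with a good ratio, the process is
  required to hit every cell of length \<open>l / 2\<close> up to a late time. This costs a positive
  constant factor, because the intensity is positive almost everywhere, and such a factor
  is invisible on the logarithmic scale (\<open>survive_ge_exp\<close>).
\<close>

section \<open>The first long gap of a locally finite set\<close>

lemma locally_finite_has_min:
  fixes S A :: "real set"
  assumes "\<And>t. finite (S \<inter> {..t})" "A \<subseteq> S" "A \<noteq> {}"
  obtains a where "a \<in> A" "\<And>b. b \<in> A \<Longrightarrow> a \<le> b"
proof -
  obtain x where x: "x \<in> A" using assms by auto
  define F where "F = A \<inter> {..x}"
  have F: "finite F" unfolding F_def using assms(1)[of x] assms(2)
    by (rule_tac finite_subset[of _ "S \<inter> {..x}"]) auto
  have ne: "x \<in> F" using x by (auto simp: F_def)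
  show ?thesis
  proof (rule that[of "Min F"])
    show "Min F \<in> A" using Min_in[OF F] ne by (auto simp: F_def)
    show "Min F \<le> b" if "b \<in> A" for b
    proof (cases "b \<le> x")
      case True then show ?thesis using that F by (auto simp: F_def)
    next
      case False
      have "Min F \<le> x" using F ne by auto
      then show ?thesis using False by auto
    qed
  qed
qed

lemma Inf_ereal_image_min:
  assumes "a \<in> A" "\<And>b. b \<in> A \<Longrightarrow> a \<le> b"
  shows "Inf (ereal ` A) = ereal a"
  using assms by (intro antisym Inf_lower Inf_greatest) auto

text \<open>
  Local finiteness turns the infimum in the definition of \<^const>\<open>epoch\<close> into a minimum, so the next
  epoch is the successor of the current one among the points.
\<close>

lemma epoch_Suc_real:
  fixes S :: "real set"
  assumes lf: "\<And>t. finite (S \<inter> {..t})" and e: "epoch S n = ereal r"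
  shows "(\<forall>s\<in>S. s \<le> r) \<and> epoch S (Suc n) = \<infinity> \<or>
    (\<exists>s\<in>S. r < s \<and> (\<forall>s'\<in>S. r < s' \<longrightarrow> s \<le> s') \<and> epoch S (Suc n) = ereal s)"
proof (cases "{s\<in>S. r < s} = {}")
  case True
  then have eq: "{s\<in>S. epoch S n < ereal s} = {}" using e by auto
  have "epoch S (Suc n) = \<infinity>" unfolding epoch.simps eq by (simp add: top_ereal_def)
  then show ?thesis using True by force
next
  case False
  then obtain a where a: "a \<in> {s\<in>S. r < s}" "\<And>b. b \<in> {s\<in>S. r < s} \<Longrightarrow> a \<le> b"
    using locally_finite_has_min[OF lf, of "{s\<in>S. r < s}"] by (metis (lifting) mem_Collect_eq subsetI)
  have "epoch S (Suc n) = ereal a"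
    using Inf_ereal_image_min[of a "{s\<in>S. r < s}"] a by (simp add: e)
  then show ?thesis using a by blast
qed

lemma epoch_values:
  assumes lf: "\<And>t. finite (S \<inter> {..t})"
  shows "epoch S n = \<infinity> \<or> epoch S n \<in> ereal ` insert 0 S"
proof (induction n)
  case 0
  then show ?case by (auto simp: zero_ereal_def)
next
  case (Suc n)
  show ?case
  proof (cases "epoch S n = \<infinity>")
    case True
    then show ?thesis by (simp add: top_ereal_def)
  next
    case False
    then obtain r where "epoch S n = ereal r" using Suc by auto
    from epoch_Suc_real[OF lf this] show ?thesis by blast
  qed
qed

text \<open>
  Induction on the number of earlier points: the predecessor of a point, or \<open>0\<close> if there is none, is an
  epoch, and the point is then the next one.
\<close>

lemma every_point_is_epoch:
  assumes lf: "\<And>t. finite (S \<inter> {..t})" and pos: "S \<subseteq> {0<..}" and "s \<in> insert 0 S"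
  shows "\<exists>n. epoch S n = ereal s"
  using \<open>s \<in> insert 0 S\<close>
proof (induction "card (insert 0 S \<inter> {..<s})" arbitrary: s rule: less_induct)
  case less
  show ?case
  proof (cases "s = 0")
    case True
    then show ?thesis by (intro exI[of _ 0]) (simp add: zero_ereal_def)
  next
    case False
    then have s: "s \<in> S" "0 < s" using less pos by auto
    let ?F = "insert 0 S \<inter> {..<s}"
    have F: "finite ?F" using lf[of s] by (auto intro: finite_subset[of _ "insert 0 (S \<inter> {..s})"])
    have F0: "0 \<in> ?F" using s by auto
    define r where "r = Max ?F"
    have r: "r \<in> ?F" unfolding r_def using Max_in F F0 by blast
    have rmax: "q \<le> r" if "q \<in> ?F" for q unfolding r_def using that F by auto
    have "insert 0 S \<inter> {..<r} \<subset> ?F" using r by auto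
    then obtain n where n: "epoch S n = ereal r"
      using less.hyps[of r] psubset_card_mono[OF F] r by blast
    from epoch_Suc_real[OF lf n] s r obtain s' where
      s': "s' \<in> S" "r < s'" "\<forall>q\<in>S. r < q \<longrightarrow> s' \<le> q" "epoch S (Suc n) = ereal s'"
      by force
    have "s' \<le> s" using s' s r by auto
    moreover have "\<not> s' < s" using rmax[of s'] s' by auto
    ultimately show ?thesis using s' by (metis order_le_less)
  qed
qed

text \<open>
  The epochs that are followed by a gap of length at least \<open>l\<close> are exactly the points \<open>s\<close>, with
  \<open>0\<close> included, for which \<open>(s, s + l)\<close> is empty. By local finiteness their infimum is attained, so a
  strict lower bound for each of them is a strict lower bound for the infimum.
\<close>

lemma first_gap_gt_iff:
  assumes lf: "\<And>t. finite (S \<inter> {..t})" and pos: "S \<subseteq> {0<..}"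
  shows "ereal t < first_gap l S \<longleftrightarrow> (\<forall>s\<in>insert 0 S. s \<le> t \<longrightarrow> S \<inter> {s<..<s + l} \<noteq> {})"
proof -
  define X where "X = {s\<in>insert 0 S. S \<inter> {s<..<s + l} = {}}"
  have key: "epoch S (Suc n) - epoch S n \<ge> ereal l \<longleftrightarrow> S \<inter> {r<..<r + l} = {}"
    if n: "epoch S n = ereal r" for n r
    using epoch_Suc_real[OF lf n]
  proof
    assume "(\<forall>s\<in>S. s \<le> r) \<and> epoch S (Suc n) = \<infinity>"
    then show ?thesis using n by (auto simp: disjoint_iff simp del: epoch.simps)
  next
    assume "\<exists>s\<in>S. r < s \<and> (\<forall>s'\<in>S. r < s' \<longrightarrow> s \<le> s') \<and> epoch S (Suc n) = ereal s"
    then obtain s where s: "s \<in> S" "r < s" "\<And>q. q \<in> S \<Longrightarrow> r < q \<Longrightarrow> s \<le> q"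
      "epoch S (Suc n) = ereal s" by blast
    have "(ereal l \<le> ereal s - ereal r) = (r + l \<le> s)" by auto
    also have "\<dots> \<longleftrightarrow> S \<inter> {r<..<r + l} = {}"
      using s(1-3) by (force simp: disjoint_iff)
    finally show ?thesis unfolding n s(4) .
  qed
  have X: "{epoch S n |n. epoch S n < \<infinity> \<and> epoch S (Suc n) - epoch S n \<ge> ereal l} = ereal ` X"
    (is "?L = _")
  proof (intro equalityI subsetI)
    fix e assume "e \<in> ?L"
    then obtain n where n: "e = epoch S n" "epoch S n < \<infinity>" "epoch S (Suc n) - epoch S n \<ge> ereal l"
      by blast
    then obtain r where r: "epoch S n = ereal r" "r \<in> insert 0 S" using epoch_values[OF lf, of n] by auto
    show "e \<in> ereal ` X" using n(1,3) r key[OF r(1)] by (auto simp: X_def simp del: epoch.simps)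
  next
    fix e assume "e \<in> ereal ` X"
    then obtain r where r: "e = ereal r" "r \<in> insert 0 S" "S \<inter> {r<..<r + l} = {}" by (auto simp: X_def)
    from every_point_is_epoch[OF lf pos r(2)] obtain n where n: "epoch S n = ereal r" by blast
    show "e \<in> ?L" using n key[OF n] r by (auto simp del: epoch.simps intro!: exI[of _ n])
  qed
  have "ereal t < first_gap l S \<longleftrightarrow> (\<forall>s\<in>X. t < s)"
  proof (cases "X = {}")
    case True
    then show ?thesis unfolding first_gap_def X by (simp add: top_ereal_def)
  next
    case False
    have "finite (insert 0 S \<inter> {..t})" for t
      using lf[of t] by (auto intro: finite_subset[of _ "insert 0 (S \<inter> {..t})"])
    then obtain a where a: "a \<in> X" "\<And>b. b \<in> X \<Longrightarrow> a \<le> b"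
      using locally_finite_has_min[of "insert 0 S" X] False by (auto simp: X_def)
    have "Inf (ereal ` X) = ereal a" using a by (rule Inf_ereal_image_min)
    then show ?thesis unfolding first_gap_def X using a by force
  qed
  also have "\<dots> \<longleftrightarrow> (\<forall>s\<in>insert 0 S. s \<le> t \<longrightarrow> S \<inter> {s<..<s + l} \<noteq> {})"
    by (auto simp: X_def not_less[symmetric])
  finally show ?thesis .
qed

section \<open>Detection of long gaps on a grid\<close>

lemma grid_cell:
  fixes x h s :: real
  assumes "x < s" "s \<le> x + h * real m"
  shows "\<exists>k<m. x + h * real k < s \<and> s \<le> x + h * real (Suc k)"
  using assms(2)
proof (induction m)
  case 0
  then show ?case using assms by simp
next
  case (Suc m)
  then show ?case by (cases "s \<le> x + h * real m") (auto intro: less_SucI)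
qed

definition grid :: "real \<Rightarrow> real \<Rightarrow> nat \<Rightarrow> nat \<Rightarrow> real" where
  "grid x y m k = x + (y - x) / real m * real k"

lemma grid_bounds:
  assumes "x < y" "k < m"
  shows "x \<le> grid x y m k" "grid x y m (Suc k) = grid x y m k + (y - x) / real m"
    "grid x y m (Suc k) \<le> y" "grid x y m k < grid x y m (Suc k)"
proof -
  show 1: "grid x y m (Suc k) = grid x y m k + (y - x) / real m" by (simp add: grid_def distrib_left)
  then show "grid x y m k < grid x y m (Suc k)" using assms by simp
  show "x \<le> grid x y m k" using assms by (simp add: grid_def)
  have "(y - x) / real m * real (Suc k) \<le> (y - x) / real m * real m"
    using assms by (intro mult_left_mono) auto
  then show "grid x y m (Suc k) \<le> y" using assms by (simp add: grid_def)
qed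

lemma grid_strict_mono:
  assumes "x < y" "0 < m" "i < j"
  shows "grid x y m i < grid x y m j"
  using assms unfolding grid_def by (intro add_strict_left_mono mult_strict_left_mono) auto

lemma ex_grid_cell:
  assumes "x < s" "s \<le> y" "0 < m"
  shows "\<exists>k<m. grid x y m k < s \<and> s \<le> grid x y m (Suc k)"
  using grid_cell[of x s "(y - x) / real m" m] assms by (simp add: grid_def)

text \<open>
  A condition on all points of a random set becomes a countable combination of
  conditions on fixed sets. The window \<open>(p_(k+1), p_k + l)\<close> is contained in \<open>(s, s + l)\<close> for every
  point \<open>s\<close> of the \<open>k\<close>-th cell, which gives one direction. In the other direction, suppose that each of
  the finitely many points of \<open>(x, y]\<close> were followed by another point at distance less than
  \<open>l\<close>. On a grid that is finer than all these margins, the second point would lie in the window.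
\<close>

lemma gap_start_iff_grid:
  fixes S :: "real set"
  assumes lf: "\<And>t. finite (S \<inter> {..t})" and xy: "x < y"
  shows "(\<exists>s\<in>S. x < s \<and> s \<le> y \<and> S \<inter> {s<..<s + l} = {}) \<longleftrightarrow>
    (\<forall>m>0. \<exists>k<m. S \<inter> {grid x y m k<..grid x y m (Suc k)} \<noteq> {} \<and>
       S \<inter> {grid x y m (Suc k)<..<grid x y m k + l} = {})"
    (is "?L \<longleftrightarrow> ?R")
proof
  assume ?L
  then obtain s where s: "s \<in> S" "x < s" "s \<le> y" "S \<inter> {s<..<s + l} = {}" by blast
  show ?R
  proof (intro allI impI)
    fix m :: nat assume m: "m > 0"
    from ex_grid_cell[OF s(2,3) m] obtain k where
      k: "k < m" "grid x y m k < s" "s \<le> grid x y m (Suc k)" by blast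
    show "\<exists>k<m. S \<inter> {grid x y m k<..grid x y m (Suc k)} \<noteq> {} \<and>
       S \<inter> {grid x y m (Suc k)<..<grid x y m k + l} = {}"
    proof (intro exI[of _ k] conjI)
      show "S \<inter> {grid x y m k<..grid x y m (Suc k)} \<noteq> {}"
        using s(1) k by auto
      show "S \<inter> {grid x y m (Suc k)<..<grid x y m k + l} = {}"
        using s(4) k(2,3) by (force simp: disjoint_iff)
    qed (rule k)
  qed
next
  assume R: ?R
  show ?L
  proof (rule ccontr)
    assume nL: "\<not> ?L"
    define F where "F = S \<inter> {x<..y}"
    define h where "h = (\<lambda>m. (y - x) / real (Suc m))"
    have F: "finite F" unfolding F_def using lf[of y] by (rule finite_subset[rotated]) auto
    have h0: "h \<longlonglongrightarrow> 0" unfolding h_def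
      by (rule LIMSEQ_Suc[where f = "\<lambda>m. (y - x) / real m"]) (rule lim_const_over_n)
    have "\<forall>s\<in>F. \<forall>\<^sub>F m in sequentially. \<exists>q\<in>S. s + h m < q \<and> q < s + l - h m"
    proof
      fix s assume "s \<in> F"
      then have "S \<inter> {s<..<s + l} \<noteq> {}" using nL by (auto simp: F_def)
      then obtain q where q: "q \<in> S" "s < q" "q < s + l" by auto
      have "\<forall>\<^sub>F m in sequentially. h m < min (q - s) (s + l - q)"
        by (rule order_tendstoD(2)[OF h0]) (use q in auto)
      then show "\<forall>\<^sub>F m in sequentially. \<exists>q\<in>S. s + h m < q \<and> q < s + l - h m"
        by eventually_elim (use q in \<open>auto intro!: bexI[of _ q]\<close>)
    qed
    then have "\<forall>\<^sub>F m in sequentially. \<forall>s\<in>F. \<exists>q\<in>S. s + h m < q \<and> q < s + l - h m"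
      by (rule eventually_ball_finite[OF F])
    then obtain m where m: "\<And>s. s \<in> F \<Longrightarrow> \<exists>q\<in>S. s + h m < q \<and> q < s + l - h m"
      by (auto simp: eventually_sequentially)
    from R[rule_format, of "Suc m"] obtain k where k: "k < Suc m"
      "S \<inter> {x + h m * real k<..x + h m * real (Suc k)} \<noteq> {}"
      "S \<inter> {x + h m * real (Suc k)<..<x + h m * real k + l} = {}"
      unfolding h_def grid_def by blast
    then obtain s where s: "s \<in> S" "x + h m * real k < s" "s \<le> x + h m * real (Suc k)" by auto
    have hpos: "h m > 0" using xy by (simp add: h_def)
    have "h m * real (Suc k) \<le> h m * real (Suc m)"
      using k(1) hpos by (intro mult_left_mono) auto
    also have "\<dots> = y - x" by (simp add: h_def)
    finally have "s \<in> F" using s hpos by (auto simp: F_def intro: le_less_trans[of x "x + h m * real k"])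
    from m[OF this] obtain q where "q \<in> S" "s + h m < q" "q < s + l - h m" by blast
    moreover have "h m * real (Suc k) = h m * real k + h m" by (simp add: algebra_simps)
    ultimately have "q \<in> S \<inter> {x + h m * real (Suc k)<..<x + h m * real k + l}"
      using s by auto
    then show False using k(3) by blast
  qed
qed

section \<open>Void events and independence\<close>

locale poisson_gaps =
  fixes P :: "'w measure" and N :: "'w \<Rightarrow> real set" and \<mu> :: "real \<Rightarrow> real" and l :: real
  assumes l_pos: "0 < l"
    and poisson: "poisson_point_process P N \<mu>"
    and finite_mass: "\<And>t. emeasure (intensity_measure \<mu>) {0<..<t} < \<infinity>"

sublocale poisson_gaps \<subseteq> prob_space P
  using poisson unfolding poisson_point_process_def by blast

context poisson_gaps
begin

abbreviation mass :: "real set \<Rightarrow> real" where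
  "mass B \<equiv> measure (intensity_measure \<mu>) B"

text \<open>
  Boundedness makes both the mass of a set and its number of points finite.
\<close>

definition bounded_sets :: "real set \<Rightarrow> real set set" where
  "bounded_sets I = {B \<in> sets borel. B \<subseteq> I \<inter> {0<..} \<and> bounded B}"

definition void :: "real set \<Rightarrow> 'w set" where
  "void B = {\<omega>\<in>space P. N \<omega> \<inter> B = {}}"

definition hit :: "real set \<Rightarrow> 'w set" where
  "hit B = {\<omega>\<in>space P. N \<omega> \<inter> B \<noteq> {}}"

text \<open>
  What can be observed of the process inside \<open>I\<close>. Void events serve as generators because they form
  a \<open>\<pi>\<close>-system with known probabilities.
\<close>

definition history :: "real set \<Rightarrow> 'w set set" where
  "history I = sigma_sets (space P) (void ` bounded_sets I)"

definition gap_in :: "real \<Rightarrow> real \<Rightarrow> 'w set" where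
  "gap_in x y = {\<omega>\<in>space P. \<exists>s\<in>N \<omega>. x < s \<and> s \<le> y \<and> N \<omega> \<inter> {s<..<s + l} = {}}"

definition survive :: "real \<Rightarrow> 'w set" where
  "survive t = {\<omega>\<in>space P. ereal t < first_gap l (N \<omega>)}"

lemma points_locally_finite: "\<omega> \<in> space P \<Longrightarrow> finite (N \<omega> \<inter> {..t})"
  and points_pos: "\<omega> \<in> space P \<Longrightarrow> N \<omega> \<subseteq> {0<..}"
  using poisson unfolding poisson_point_process_def by blast+

lemma sets_intensity [measurable_cong, simp]: "sets (intensity_measure \<mu>) = sets borel"
  by (simp add: intensity_measure_def)

lemma intensity_measurable [measurable]:
  "(\<lambda>t. indicator {0<..} t * ennreal (\<mu> t)) \<in> borel_measurable borel"
proof -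
  have "(\<lambda>t. indicator {0<..} t *\<^sub>R \<mu> t) \<in> borel_measurable borel"
    using poisson unfolding poisson_point_process_def set_borel_measurable_def by blast
  then have "(\<lambda>t. ennreal (indicator {0<..} t *\<^sub>R \<mu> t)) \<in> borel_measurable borel" by measurable
  also have "(\<lambda>t. ennreal (indicator {0<..} t *\<^sub>R \<mu> t)) = (\<lambda>t. indicator {0<..} t * ennreal (\<mu> t))"
    by (auto simp: indicator_def)
  finally show ?thesis .
qed

lemma bounded_setsI:
  "B \<in> sets borel \<Longrightarrow> B \<subseteq> I \<Longrightarrow> B \<subseteq> {0<..<u} \<Longrightarrow> B \<in> bounded_sets I"
  unfolding bounded_sets_def using bounded_subset[of "{0<..<u}" B] by fastforce

lemma bounded_setsD:
  assumes "B \<in> bounded_sets I"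
  shows "B \<in> sets borel" "B \<subseteq> I" "B \<subseteq> {0<..}" "bounded B" "\<exists>u. B \<subseteq> {0<..<u}"
proof -
  show B: "B \<in> sets borel" "B \<subseteq> I" "B \<subseteq> {0<..}" "bounded B"
    using assms by (auto simp: bounded_sets_def)
  obtain u where "\<And>x. x \<in> B \<Longrightarrow> norm x < u" using B(4) by (auto simp: bounded_pos_less)
  then show "\<exists>u. B \<subseteq> {0<..<u}" using B(3) by (force intro!: exI[of _ u])
qed

lemma emeasure_bounded_sets:
  assumes "B \<in> bounded_sets I"
  shows "emeasure (intensity_measure \<mu>) B < \<infinity>"
proof -
  obtain u where "B \<subseteq> {0<..<u}" using bounded_setsD[OF assms] by blast
  then have "emeasure (intensity_measure \<mu>) B \<le> emeasure (intensity_measure \<mu>) {0<..<u}"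
    by (intro emeasure_mono) auto
  then show ?thesis using finite_mass[of u] by (rule le_less_trans)
qed

lemma mass_Un:
  assumes "B \<in> bounded_sets I" "C \<in> bounded_sets J" "B \<inter> C = {}"
  shows "mass (B \<union> C) = mass B + mass C"
  using emeasure_bounded_sets[OF assms(1)] emeasure_bounded_sets[OF assms(2)]
    bounded_setsD(1)[OF assms(1)] bounded_setsD(1)[OF assms(2)] assms(3)
  by (intro measure_Union) auto

lemma bounded_sets_Un:
  "B \<in> bounded_sets I \<Longrightarrow> C \<in> bounded_sets I \<Longrightarrow> B \<union> C \<in> bounded_sets I"
  by (auto simp: bounded_sets_def)

lemma bounded_sets_mono: "I \<subseteq> J \<Longrightarrow> B \<in> bounded_sets I \<Longrightarrow> B \<in> bounded_sets J"
  by (auto simp: bounded_sets_def)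

lemma void_event: "B \<in> bounded_sets I \<Longrightarrow> void B \<in> events"
  and prob_void: "B \<in> bounded_sets I \<Longrightarrow> prob (void B) = exp (- mass B)"
proof -
  assume B: "B \<in> bounded_sets I"
  obtain u where u: "B \<subseteq> {0<..<u}" using bounded_setsD[OF B] by blast
  have "finite (N \<omega> \<inter> B)" if "\<omega> \<in> space P" for \<omega>
    using points_locally_finite[OF that, of u] by (rule finite_subset[rotated]) (use u in auto)
  then have eq: "void B = {\<omega>\<in>space P. card (N \<omega> \<inter> B) = 0}"
    by (auto simp: void_def)
  have *: "(\<lambda>\<omega>. card (N \<omega> \<inter> B)) \<in> measurable P (count_space UNIV)"
    "prob {\<omega> \<in> space P. card (N \<omega> \<inter> B) = 0} = mass B ^ 0 / fact 0 * exp (- mass B)"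
    using poisson emeasure_bounded_sets[OF B] bounded_setsD[OF B]
    unfolding poisson_point_process_def by blast+
  have "{\<omega>\<in>space P. card (N \<omega> \<inter> B) = 0} \<in> events" using *(1) by measurable
  then show "void B \<in> events" "prob (void B) = exp (- mass B)" using eq *(2) by auto
qed

lemma hit_eq: "hit B = space P - void B"
  by (auto simp: hit_def void_def)

lemma void_Int: "void B \<inter> void C = void (B \<union> C)"
  by (auto simp: void_def)

lemma history_sigma_algebra: "sigma_algebra (space P) (history I)"
  unfolding history_def by (intro sigma_algebra_sigma_sets) (auto simp: void_def)

lemma void_history: "B \<in> bounded_sets I \<Longrightarrow> void B \<in> history I"
  unfolding history_def by (auto intro: sigma_sets.Basic)

lemma hit_history: "B \<in> bounded_sets I \<Longrightarrow> hit B \<in> history I"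
  unfolding hit_eq history_def by (auto intro: sigma_sets.intros)

lemma history_mono: "I \<subseteq> J \<Longrightarrow> history I \<subseteq> history J"
  unfolding history_def by (intro sigma_sets_mono') (auto intro: bounded_sets_mono)

lemma history_events: "A \<in> history I \<Longrightarrow> A \<in> events"
proof -
  have "history I \<subseteq> events" unfolding history_def
    by (intro sets.sigma_sets_subset) (auto intro: void_event)
  then show "A \<in> history I \<Longrightarrow> A \<in> events" by blast
qed

text \<open>
  The intersection of two void events is the void event of the union, so void events form a
  \<open>\<pi>\<close>-system, and additivity of the mass makes their probabilities multiply.
  Independence passes to the generated \<open>\<sigma>\<close>-algebras.
\<close>

lemma prob_history_Int:
  assumes A: "A \<in> history I" and B: "B \<in> history J" and IJ: "I \<inter> J = {}"
  shows "prob (A \<inter> B) = prob A * prob B"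
proof -
  have st: "Int_stable (void ` bounded_sets K)" for K
    by (auto simp: Int_stable_def void_Int intro!: imageI bounded_sets_Un)
  have "indep_set (void ` bounded_sets I) (void ` bounded_sets J)"
  proof (rule indep_setI)
    fix a b assume "a \<in> void ` bounded_sets I" "b \<in> void ` bounded_sets J"
    then obtain C D where CD: "C \<in> bounded_sets I" "a = void C" "D \<in> bounded_sets J" "b = void D" by blast
    have dis: "C \<inter> D = {}" using IJ bounded_setsD(2)[OF CD(1)] bounded_setsD(2)[OF CD(3)] by blast
    have "C \<union> D \<in> bounded_sets (I \<union> J)"
      using CD by (intro bounded_sets_Un) (auto intro: bounded_sets_mono[rotated])
    then have "prob (a \<inter> b) = exp (- mass (C \<union> D))" by (simp add: CD void_Int prob_void)
    also have "\<dots> = prob a * prob b"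
      using mass_Un[OF CD(1,3) dis] by (simp add: CD prob_void[OF CD(1)] prob_void[OF CD(3)] exp_add[symmetric])
    finally show "prob (a \<inter> b) = prob a * prob b" .
  qed (auto intro: void_event)
  then have "indep_set (history I) (history J)"
    unfolding history_def by (rule indep_set_sigma_sets[OF _ st st])
  then show ?thesis using A B by (rule indep_setD)
qed

lemma gap_in_event:
  assumes "0 \<le> x"
  shows "gap_in x y \<in> history {x<..<y + l}"
proof (cases "x < y")
  case False
  then have "gap_in x y = {}" by (auto simp: gap_in_def)
  then show ?thesis unfolding history_def by (auto intro: sigma_sets.Empty)
next
  case True
  interpret H: sigma_algebra "space P" "history {x<..<y + l}" by (rule history_sigma_algebra)
  have cells: "{grid x y m k<..grid x y m (Suc k)} \<in> bounded_sets {x<..<y + l}"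
    "{grid x y m (Suc k)<..<grid x y m k + l} \<in> bounded_sets {x<..<y + l}" if "k < m" for m k
    using grid_bounds[OF True that] assms l_pos by (auto intro!: bounded_setsI[where u = "y + l"])
  have "gap_in x y = (\<Inter>m\<in>{0<..}. \<Union>k\<in>{..<m}. hit {grid x y m k<..grid x y m (Suc k)} \<inter> void {grid x y m (Suc k)<..<grid x y m k + l})"
    (is "_ = ?grid_event")
  proof (rule set_eqI)
    fix \<omega>
    show "\<omega> \<in> gap_in x y \<longleftrightarrow> \<omega> \<in> ?grid_event"
    proof (cases "\<omega> \<in> space P")
      case True
      then have "\<omega> \<in> ?grid_event \<longleftrightarrow> (\<forall>m>0. \<exists>k<m. N \<omega> \<inter> {grid x y m k<..grid x y m (Suc k)} \<noteq> {} \<and>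
         N \<omega> \<inter> {grid x y m (Suc k)<..<grid x y m k + l} = {})"
        by (simp add: hit_def void_def) (simp add: Ball_def Bex_def)
      then show ?thesis
        using gap_start_iff_grid[OF points_locally_finite[OF True] \<open>x < y\<close>, of l] True by (simp add: gap_in_def)
    next
      case False
      then have "\<omega> \<notin> ?grid_event" by (auto simp: hit_def intro!: bexI[of _ 1])
      then show ?thesis using False by (simp add: gap_in_def)
    qed
  qed
  also have "\<dots> \<in> history {x<..<y + l}"
  proof (rule H.countable_INT')
    show "(\<lambda>m. \<Union>k\<in>{..<m}. hit {grid x y m k<..grid x y m (Suc k)} \<inter> void {grid x y m (Suc k)<..<grid x y m k + l}) ` {0<..}
      \<subseteq> history {x<..<y + l}"
    proof (rule image_subsetI)
      fix m :: nat
      show "(\<Union>k\<in>{..<m}. hit {grid x y m k<..grid x y m (Suc k)} \<inter> void {grid x y m (Suc k)<..<grid x y m k + l})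
        \<in> history {x<..<y + l}"
      proof (rule H.finite_UN)
        fix k assume "k \<in> {..<m}"
        then have "k < m" by simp
        then show "hit {grid x y m k<..grid x y m (Suc k)} \<inter> void {grid x y m (Suc k)<..<grid x y m k + l}
          \<in> history {x<..<y + l}"
          by (intro H.Int hit_history[OF cells(1)] void_history[OF cells(2)])
      qed simp
    qed
  qed auto
  finally show ?thesis .
qed

text \<open>
  The origin is an epoch without being a point, so the first gap has to be excluded separately.
\<close>

lemma survive_eq:
  assumes "0 \<le> t"
  shows "survive t = hit {0<..<l} - gap_in 0 t"
proof -
  have "ereal t < first_gap l (N \<omega>) \<longleftrightarrow> N \<omega> \<inter> {0<..<l} \<noteq> {} \<and> \<not> (\<exists>s\<in>N \<omega>. 0 < s \<and> s \<le> t \<and> N \<omega> \<inter> {s<..<s + l} = {})"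
    if "\<omega> \<in> space P" for \<omega>
    using assms points_pos[OF that]
    by (subst first_gap_gt_iff[OF points_locally_finite points_pos]) (use that in auto)
  then show ?thesis by (auto simp: survive_def hit_def gap_in_def)
qed

lemma survive_step:
  assumes "0 \<le> s" "s \<le> t"
  shows "survive t = survive s - gap_in s t"
proof -
  have "gap_in 0 t = gap_in 0 s \<union> gap_in s t"
  proof (intro equalityI subsetI)
    fix \<omega> assume "\<omega> \<in> gap_in 0 t"
    then obtain q where "\<omega> \<in> space P" "q \<in> N \<omega>" "0 < q" "q \<le> t" "N \<omega> \<inter> {q<..<q + l} = {}"
      by (auto simp: gap_in_def)
    then show "\<omega> \<in> gap_in 0 s \<union> gap_in s t" by (cases "q \<le> s") (auto simp: gap_in_def)
  next
    fix \<omega> assume "\<omega> \<in> gap_in 0 s \<union> gap_in s t"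
    then obtain q where "\<omega> \<in> space P" "q \<in> N \<omega>" "0 < q" "q \<le> t" "N \<omega> \<inter> {q<..<q + l} = {}"
      using assms by (force simp: gap_in_def)
    then show "\<omega> \<in> gap_in 0 t" by (auto simp: gap_in_def)
  qed
  then show ?thesis using assms by (auto simp: survive_eq)
qed

lemma survive_event:
  assumes "0 \<le> t"
  shows "survive t \<in> history {0<..<t + l}"
proof -
  interpret H: sigma_algebra "space P" "history {0<..<t + l}" by (rule history_sigma_algebra)
  have "{0<..<l} \<in> bounded_sets {0<..<t + l}"
    using assms by (intro bounded_setsI[where u = l]) auto
  then show ?thesis unfolding survive_eq[OF assms]
    using gap_in_event[of 0 t] by (intro H.Diff hit_history) auto
qed

section \<open>The probability that a long gap starts in a block\<close>

lemma mass_bounds: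
  assumes B: "B \<in> bounded_sets I" and \<mu>: "\<And>s. s \<in> B \<Longrightarrow> lo \<le> \<mu> s \<and> \<mu> s \<le> hi" and lo: "0 \<le> lo"
  shows "lo * measure lborel B \<le> mass B" "mass B \<le> hi * measure lborel B"
proof -
  note BD = bounded_setsD[OF B]
  have B_borel[measurable]: "B \<in> sets lborel" using BD(1) by simp
  have fin: "emeasure lborel B < \<infinity>" by (rule emeasure_bounded_finite) (rule BD)
  then have lb: "emeasure lborel B = ennreal (measure lborel B)"
    by (intro emeasure_eq_ennreal_measure) auto
  have mB: "emeasure (intensity_measure \<mu>) B = ennreal (mass B)"
    using emeasure_bounded_sets[OF B] by (intro emeasure_eq_ennreal_measure) auto
  have int: "emeasure (intensity_measure \<mu>) B = (\<integral>\<^sup>+t. indicator {0<..} t * ennreal (\<mu> t) * indicator B t \<partial>lborel)"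
    unfolding intensity_measure_def by (subst emeasure_density) (use BD(1) in auto)
  have "ennreal (lo * measure lborel B) = (\<integral>\<^sup>+t. ennreal lo * indicator B t \<partial>lborel)"
    by (simp only: nn_integral_cmult_indicator[OF B_borel] lb ennreal_mult[OF lo measure_nonneg])
  also have "\<dots> \<le> emeasure (intensity_measure \<mu>) B"
    unfolding int by (intro nn_integral_mono) (use BD(3) \<mu> in \<open>auto simp: indicator_def intro!: ennreal_leI\<close>)
  finally show "lo * measure lborel B \<le> mass B" unfolding mB by (simp add: ennreal_le_iff)
  show "mass B \<le> hi * measure lborel B"
  proof (cases "B = {}")
    case False
    then have hi: "0 \<le> hi" using \<mu> lo by force
    have "emeasure (intensity_measure \<mu>) B \<le> (\<integral>\<^sup>+t. ennreal hi * indicator B t \<partial>lborel)"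
      unfolding int by (intro nn_integral_mono) (use BD(3) \<mu> in \<open>auto simp: indicator_def intro!: ennreal_leI\<close>)
    also have "\<dots> = ennreal (hi * measure lborel B)"
      by (simp only: nn_integral_cmult_indicator[OF B_borel] lb ennreal_mult[OF hi measure_nonneg])
    finally show ?thesis unfolding mB using hi by (simp add: ennreal_le_iff)
  qed simp
qed

lemma prob_hit: "B \<in> bounded_sets I \<Longrightarrow> prob (hit B) = 1 - exp (- mass B)"
  unfolding hit_eq by (subst prob_compl) (auto simp: void_event prob_void)

lemma prob_hit_void:
  assumes "B \<in> bounded_sets I" "C \<in> bounded_sets J" "I \<inter> J = {}"
  shows "prob (hit B \<inter> void C) = (1 - exp (- mass B)) * exp (- mass C)"
  using prob_history_Int[OF hit_history[OF assms(1)] void_history[OF assms(2)] assms(3)]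
    prob_hit[OF assms(1)] prob_void[OF assms(2)] by simp

text \<open>
  A union bound over the cells of a grid: if a gap starts in a cell, the cell is hit
  and a window of length \<open>l - h\<close> after it is empty, where \<open>h\<close> is the mesh. These two events are
  independent. Letting the mesh tend to \<open>0\<close> gives the expected number of long gaps with the intensity
  replaced by its extreme values.
\<close>

lemma prob_gap_in_le:
  assumes x: "0 \<le> x" and xy: "x < y" and lo: "0 \<le> lo"
    and \<mu>: "\<And>s. x < s \<Longrightarrow> s < y + l \<Longrightarrow> lo \<le> \<mu> s \<and> \<mu> s \<le> hi"
  shows "prob (gap_in x y) \<le> (y - x) * hi * exp (- (l * lo))"
proof -
  have hi: "0 \<le> hi" using \<mu>[of y] xy l_pos lo by simp
  have bound: "prob (gap_in x y) \<le> (y - x) * hi * exp (- ((l - (y - x) / real m) * lo))"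
    if m: "0 < m" for m
  proof -
    define h where "h = (y - x) / real m"
    define C where "C = (\<lambda>k. {grid x y m k<..grid x y m (Suc k)})"
    define I where "I = (\<lambda>k. {grid x y m (Suc k)<..<grid x y m k + l})"
    note g = grid_bounds[OF xy]
    have C: "C k \<in> bounded_sets {..grid x y m (Suc k)}" and I: "I k \<in> bounded_sets {grid x y m (Suc k)<..}"
      if "k < m" for k
      unfolding C_def I_def using g[OF that] x l_pos
      by (auto intro!: bounded_setsI[where u = "y + l"])
    have one: "prob (hit (C k) \<inter> void (I k)) \<le> h * hi * exp (- ((l - h) * lo))" if k: "k < m" for k
    proof -
      have "mass (C k) \<le> hi * measure lborel (C k)"
        by (rule mass_bounds[OF C[OF k]]) (use g[OF k] \<mu> lo l_pos in \<open>auto simp: C_def\<close>)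
      also have "measure lborel (C k) = h" unfolding C_def h_def using g[OF k] by simp
      finally have 1: "1 - exp (- mass (C k)) \<le> h * hi"
        using exp_ge_add_one_self[of "- mass (C k)"] by (simp add: mult.commute)
      have "(l - h) * lo \<le> lo * measure lborel (I k)"
        unfolding mult.commute[of _ lo]
        by (intro mult_left_mono lo, cases "grid x y m (Suc k) \<le> grid x y m k + l")
          (use g[OF k] in \<open>auto simp: I_def h_def\<close>)
      also have "\<dots> \<le> mass (I k)"
        by (rule mass_bounds(1)[OF I[OF k], where hi = hi]) (use g[OF k] \<mu> lo l_pos in \<open>auto simp: I_def\<close>)
      finally have 2: "exp (- mass (I k)) \<le> exp (- ((l - h) * lo))" by simp
      have "prob (hit (C k) \<inter> void (I k)) = (1 - exp (- mass (C k))) * exp (- mass (I k))"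
        by (rule prob_hit_void[OF C[OF k] I[OF k]]) auto
      also have "\<dots> \<le> h * hi * exp (- ((l - h) * lo))"
        using 1 2 hi xy by (intro mult_mono) (auto simp: h_def)
      finally show ?thesis .
    qed
    have "gap_in x y \<subseteq> (\<Union>k\<in>{..<m}. hit (C k) \<inter> void (I k))"
    proof
      fix \<omega> assume \<omega>: "\<omega> \<in> gap_in x y"
      then have sp: "\<omega> \<in> space P" by (simp add: gap_in_def)
      obtain k where "k < m" "N \<omega> \<inter> C k \<noteq> {}" "N \<omega> \<inter> I k = {}"
        using \<omega> m gap_start_iff_grid[OF points_locally_finite[OF sp] xy, of l]
        unfolding gap_in_def C_def I_def by blast
      then show "\<omega> \<in> (\<Union>k\<in>{..<m}. hit (C k) \<inter> void (I k))"
        using sp by (auto simp: hit_def void_def)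
    qed
    moreover have ev: "hit (C k) \<inter> void (I k) \<in> events" if "k < m" for k
      using hit_history[OF C[OF that]] void_event[OF I[OF that]] by (auto dest: history_events)
    ultimately have "prob (gap_in x y) \<le> prob (\<Union>k\<in>{..<m}. hit (C k) \<inter> void (I k))"
      by (intro finite_measure_mono) auto
    also have "\<dots> \<le> (\<Sum>k<m. prob (hit (C k) \<inter> void (I k)))"
      using ev by (intro finite_measure_subadditive_finite) auto
    also have "\<dots> \<le> (\<Sum>k<m. h * hi * exp (- ((l - h) * lo)))"
      using one by (intro sum_mono) auto
    also have "\<dots> = (y - x) * hi * exp (- ((l - h) * lo))" using m by (simp add: h_def)
    finally show ?thesis unfolding h_def .
  qed
  have "(\<lambda>m. (y - x) * hi * exp (- ((l - (y - x) / real m) * lo))) \<longlonglongrightarrow> (y - x) * hi * exp (- ((l - 0) * lo))"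
    by (intro tendsto_intros lim_const_over_n)
  then have "prob (gap_in x y) \<le> (y - x) * hi * exp (- ((l - 0) * lo))"
    by (rule LIMSEQ_le_const) (use bound in \<open>auto intro!: exI[of _ 1]\<close>)
  then show ?thesis by simp
qed

text \<open>
  The second Bonferroni inequality with uniform bounds. The number of pairs is estimated generously by
  \<open>m\<^sup>2\<close>.
\<close>

lemma prob_Union_ge:
  assumes H: "\<And>k. k < m \<Longrightarrow> H k \<in> events" "\<And>k. k < m \<Longrightarrow> p \<le> prob (H k)"
    and q: "\<And>i j. i < j \<Longrightarrow> j < m \<Longrightarrow> prob (H i \<inter> H j) \<le> q" and q0: "0 \<le> q"
  shows "real m * p - (real m)\<^sup>2 * q \<le> prob (\<Union>k<m. H k)"
proof -
  have "real n * p - real n * real m * q \<le> prob (\<Union>k<n. H k)" if "n \<le> m" for n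
    using that
  proof (induction n)
    case 0
    then show ?case by simp
  next
    case (Suc n)
    let ?U = "\<Union>k<n. H k"
    have ev: "?U \<in> events" "H n \<in> events" "\<And>i. i < n \<Longrightarrow> H i \<in> events" using H(1) Suc.prems by auto
    have "prob (?U \<inter> H n) = prob (\<Union>i<n. H i \<inter> H n)" by (rule arg_cong[where f = prob]) auto
    also have "\<dots> \<le> (\<Sum>i<n. prob (H i \<inter> H n))"
      using ev by (intro finite_measure_subadditive_finite) auto
    also have "\<dots> \<le> (\<Sum>i<n. q)" using q Suc.prems by (intro sum_mono) auto
    also have "\<dots> \<le> real m * q" using Suc.prems q0 by (simp add: mult_right_mono)
    finally have "prob (?U \<inter> H n) \<le> real m * q" .
    moreover have "prob (?U \<union> H n) = prob ?U + prob (H n) - prob (?U \<inter> H n)"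
      using finite_measure_Union'[OF ev(1,2)] finite_measure_Diff'[OF ev(2,1)] by (simp add: Int_commute)
    moreover have "(\<Union>k<Suc n. H k) = ?U \<union> H n" by (auto simp: lessThan_Suc)
    ultimately show ?case using Suc H(2)[of n] by (simp add: algebra_simps)
  qed
  from this[of m] show ?thesis by (simp add: power2_eq_square)
qed

text \<open>
  The event \<open>H k\<close> that the \<open>k\<close>-th cell is hit while the next \<open>l\<close> units after it are empty forces the
  last point of the cell to start a long gap. For two cells these events either exclude
  each other, because the later cell lies inside the window of the earlier one, or they require
  two disjoint windows to be empty, which has the squared probability. The number \<open>m\<close> of cells stays
  finite here: the pair term grows with it.
\<close>

lemma prob_gap_in_ge:
  assumes x: "0 \<le> x" and xy: "x < y" and lo: "0 \<le> lo" and m: "0 < m"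
    and \<mu>: "\<And>s. x < s \<Longrightarrow> s < y + l \<Longrightarrow> lo \<le> \<mu> s \<and> \<mu> s \<le> hi"
  shows "real m * ((1 - exp (- ((y - x) / real m * lo))) * exp (- (l * hi))) - (real m)\<^sup>2 * exp (- (2 * l * lo))
    \<le> prob (gap_in x y)"
proof -
  define h where "h = (y - x) / real m"
  define g where "g = grid x y m"
  define C where "C = (\<lambda>k. {g k<..g (Suc k)})"
  define I where "I = (\<lambda>k. {g (Suc k)<..<g (Suc k) + l})"
  define H where "H = (\<lambda>k. hit (C k) \<inter> void (I k))"
  note gb = grid_bounds[OF xy, where m = m, folded g_def]
  have C: "C k \<in> bounded_sets {..g (Suc k)}" and I: "I k \<in> bounded_sets {g (Suc k)<..}"
    if "k < m" for k
    unfolding C_def I_def using gb[OF that] x l_pos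
    by (auto intro!: bounded_setsI[where u = "y + l"])
  have ev: "H k \<in> events" if "k < m" for k
    unfolding H_def using hit_history[OF C[OF that]] void_event[OF I[OF that]] by (auto dest: history_events)
  have mI: "lo * l \<le> mass (I k)" "mass (I k) \<le> hi * l" if k: "k < m" for k
  proof -
    have "measure lborel (I k) = l" using l_pos by (simp add: I_def)
    moreover have "s \<in> I k \<Longrightarrow> lo \<le> \<mu> s \<and> \<mu> s \<le> hi" for s
      using gb[OF k] l_pos by (intro \<mu>) (auto simp: I_def)
    ultimately show "lo * l \<le> mass (I k)" "mass (I k) \<le> hi * l"
      using mass_bounds[OF I[OF k] _ lo] by metis+
  qed
  have one: "(1 - exp (- (h * lo))) * exp (- (l * hi)) \<le> prob (H k)" if k: "k < m" for k
  proof -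
    have "lo * measure lborel (C k) \<le> mass (C k)"
      by (rule mass_bounds(1)[OF C[OF k], where hi = hi]) (use gb[OF k] \<mu> lo l_pos in \<open>auto simp: C_def\<close>)
    moreover have "measure lborel (C k) = h" unfolding C_def h_def using gb[OF k] xy by simp
    ultimately have "(1 - exp (- (h * lo))) * exp (- (l * hi)) \<le> (1 - exp (- mass (C k))) * exp (- mass (I k))"
      using mI[OF k] lo xy by (intro mult_mono) (auto simp: h_def mult.commute)
    also have "\<dots> = prob (H k)" unfolding H_def
      by (rule prob_hit_void[OF C[OF k] I[OF k], symmetric]) auto
    finally show ?thesis .
  qed
  have two: "prob (H i \<inter> H j) \<le> exp (- (2 * l * lo))" if ij: "i < j" "j < m" for i j
  proof (cases "g (Suc j) < g (Suc i) + l")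
    case True
    have "g (Suc i) \<le> g j"
      using grid_strict_mono[OF xy m, of "Suc i" j] ij by (cases "Suc i = j") (auto simp: g_def)
    then have "C j \<subseteq> I i" using True by (auto simp: C_def I_def)
    then have "H i \<inter> H j = {}" by (auto simp: H_def hit_def void_def)
    then show ?thesis by simp
  next
    case False
    then have dis: "I i \<inter> I j = {}" by (auto simp: I_def)
    have i: "i < m" using ij by simp
    have IU: "I i \<union> I j \<in> bounded_sets UNIV"
      using I[OF i] I[OF ij(2)] by (intro bounded_sets_Un) (auto intro: bounded_sets_mono[rotated])
    have "prob (H i \<inter> H j) \<le> prob (void (I i \<union> I j))"
      by (intro finite_measure_mono void_event[OF IU]) (auto simp: H_def void_def)
    also have "\<dots> = exp (- (mass (I i) + mass (I j)))"
      unfolding prob_void[OF IU] mass_Un[OF I[OF i] I[OF ij(2)] dis] ..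
    also have "\<dots> \<le> exp (- (2 * l * lo))" using mI(1)[OF i] mI(1)[OF ij(2)] by (simp add: algebra_simps)
    finally show ?thesis .
  qed
  have sub: "(\<Union>k<m. H k) \<subseteq> gap_in x y"
  proof
    fix \<omega> assume "\<omega> \<in> (\<Union>k<m. H k)"
    then obtain k where k: "k < m" "\<omega> \<in> space P" "N \<omega> \<inter> C k \<noteq> {}" "N \<omega> \<inter> I k = {}"
      by (auto simp: H_def hit_def void_def)
    \<comment> \<open>The last point of the cell sees the rest of its cell empty, and then the window.\<close>
    define s where "s = Max (N \<omega> \<inter> C k)"
    have fin: "finite (N \<omega> \<inter> C k)"
      using points_locally_finite[OF k(2), of "g (Suc k)"] by (rule finite_subset[rotated]) (auto simp: C_def)
    have s: "s \<in> N \<omega> \<inter> C k" unfolding s_def by (rule Max_in[OF fin k(3)])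
    have "N \<omega> \<inter> {s<..<s + l} = {}"
    proof (rule ccontr)
      assume "N \<omega> \<inter> {s<..<s + l} \<noteq> {}"
      then obtain q where q: "q \<in> N \<omega>" "s < q" "q < s + l" by auto
      have "q \<notin> C k" using Max_ge[OF fin, of q] q unfolding s_def by auto
      then have "q \<in> I k" using s q by (auto simp: C_def I_def)
      then show False using k(4) q by blast
    qed
    then show "\<omega> \<in> gap_in x y"
      using s k gb[OF k(1)] by (auto simp: gap_in_def C_def intro!: bexI[of _ s])
  qed
  have "real m * ((1 - exp (- (h * lo))) * exp (- (l * hi))) - (real m)\<^sup>2 * exp (- (2 * l * lo)) \<le> prob (\<Union>k<m. H k)"
    by (rule prob_Union_ge) (use ev one two in auto)
  also have "\<dots> \<le> prob (gap_in x y)"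
    using sub gap_in_event[OF x] by (intro finite_measure_mono) (auto dest: history_events)
  finally show ?thesis unfolding h_def .
qed

end

section \<open>Bounds for the survival probability\<close>

text \<open>
  The ratio bound \<open>w (k + 1) \<ge> (1 - \<eta>) w k\<close> propagates, because it turns the recursion into
  \<open>w (k + 2) \<ge> (1 - q k / (1 - \<eta>)) w (k + 1)\<close> and \<open>q k / (1 - \<eta>) \<le> \<eta>\<close>. The factor
  \<open>1 - x\<close> with \<open>x \<le> \<eta>\<close> is at least \<open>exp (- x / (1 - \<eta>))\<close>; this produces the second power of
  \<open>1 - \<eta>\<close>.
\<close>

lemma delayed_recursion_lower_bound:
  fixes w q :: "nat \<Rightarrow> real"
  assumes \<eta>: "0 < \<eta>" "\<eta> < 1" and w: "\<And>k. 0 \<le> w k" and w1: "(1 - \<eta>) * w 0 \<le> w 1"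
    and rec: "\<And>k. w (Suc k) - q k * w k \<le> w (Suc (Suc k))"
    and q: "\<And>k. 0 \<le> q k" "\<And>k. q k \<le> \<eta> * (1 - \<eta>)"
  shows "(1 - \<eta>) * w 0 * exp (- ((\<Sum>j<k. q j) / (1 - \<eta>)\<^sup>2)) \<le> w (Suc k)"
proof -
  have "(1 - \<eta>) * w k \<le> w (Suc k) \<and> (1 - \<eta>) * w 0 * exp (- ((\<Sum>j<k. q j) / (1 - \<eta>)\<^sup>2)) \<le> w (Suc k)"
  proof (induction k)
    case 0
    then show ?case using w1 by simp
  next
    case (Suc k)
    define x where "x = q k / (1 - \<eta>)"
    have x: "0 \<le> x" "x \<le> \<eta>" using \<eta> q[of k] by (auto simp: x_def field_simps)
    have "w k \<le> w (Suc k) / (1 - \<eta>)" using Suc \<eta> by (simp add: field_simps)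
    then have "q k * w k \<le> q k * (w (Suc k) / (1 - \<eta>))" using q(1) by (rule mult_left_mono)
    then have step: "(1 - x) * w (Suc k) \<le> w (Suc (Suc k))"
      using rec[of k] by (simp add: x_def algebra_simps)
    have 1: "(1 - \<eta>) * w (Suc k) \<le> w (Suc (Suc k))"
      by (rule order_trans[OF _ step]) (use x w in \<open>auto intro!: mult_right_mono\<close>)
    define y where "y = x / (1 - \<eta>)"
    have y: "0 \<le> y" using x \<eta> by (simp add: y_def)
    have "(1 - x) * (1 + y) = 1 + x * (\<eta> - x) / (1 - \<eta>)"
      using \<eta> by (simp add: y_def divide_simps) (simp add: algebra_simps)
    also have "\<dots> \<ge> 1" using x \<eta> by simp
    finally have "1 \<le> (1 - x) * (1 + y)" .
    also have "\<dots> \<le> (1 - x) * exp y"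
      using x \<eta> exp_ge_add_one_self[of y] by (intro mult_left_mono) auto
    finally have "exp (- y) \<le> 1 - x" by (simp add: exp_minus field_simps)
    then have "w (Suc k) * exp (- y) \<le> w (Suc k) * (1 - x)" using w by (intro mult_left_mono)
    then have "w (Suc k) * exp (- y) \<le> w (Suc (Suc k))" using step by (simp add: mult.commute)
    moreover have "(1 - \<eta>) * w 0 * exp (- ((\<Sum>j<k. q j) / (1 - \<eta>)\<^sup>2)) * exp (- y) \<le> w (Suc k) * exp (- y)"
      using Suc by (intro mult_right_mono) auto
    moreover have "exp (- ((\<Sum>j<Suc k. q j) / (1 - \<eta>)\<^sup>2)) = exp (- ((\<Sum>j<k. q j) / (1 - \<eta>)\<^sup>2)) * exp (- y)"
      by (simp add: y_def x_def power2_eq_square exp_add[symmetric] add_divide_distrib)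
    ultimately have "(1 - \<eta>) * w 0 * exp (- ((\<Sum>j<Suc k. q j) / (1 - \<eta>)\<^sup>2)) \<le> w (Suc (Suc k))"
      by (metis mult.assoc order_trans)
    then show ?case using 1 by blast
  qed
  then show ?thesis ..
qed

context poisson_gaps
begin

lemma mass_pos:
  assumes pos: "AE t in lborel. 0 \<le> t \<longrightarrow> 0 < \<mu> t" and uv: "0 \<le> u" "u < v"
  shows "0 < mass {u<..v}"
proof (rule ccontr)
  assume "\<not> 0 < mass {u<..v}"
  then have "mass {u<..v} = 0" using measure_nonneg[of "intensity_measure \<mu>" "{u<..v}"] by linarith
  moreover have "{u<..v} \<in> bounded_sets UNIV" using uv by (intro bounded_setsI[where u = "v + 1"]) auto
  ultimately have "emeasure (intensity_measure \<mu>) {u<..v} = 0"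
    using emeasure_bounded_sets[of "{u<..v}" UNIV] by (subst emeasure_eq_ennreal_measure) auto
  then have "(\<integral>\<^sup>+t. indicator {0<..} t * ennreal (\<mu> t) * indicator {u<..v} t \<partial>lborel) = 0"
    unfolding intensity_measure_def by (subst (asm) emeasure_density) auto
  then have "AE t in lborel. indicator {0<..} t * ennreal (\<mu> t) * indicator {u<..v} t = 0"
    by (subst (asm) nn_integral_0_iff_AE) auto
  with pos have "AE t in lborel. t \<notin> {u<..v}"
    by eventually_elim (use uv in \<open>auto simp: indicator_def split: if_splits\<close>)
  then have "{u<..v} \<in> null_sets lborel" by (subst AE_iff_null_sets) auto
  then show False using uv by (auto simp: null_sets_def)
qed

lemma survive_events: "0 \<le> t \<Longrightarrow> survive t \<in> events"
  using survive_event history_events by blast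

lemma survive_antimono: "0 \<le> s \<Longrightarrow> s \<le> t \<Longrightarrow> prob (survive t) \<le> prob (survive s)"
  using survive_step[of s t] survive_events[of s] by (intro finite_measure_mono) auto

text \<open>
  The event \<open>D > t\<close> is decided by the points before \<open>t + l\<close>, so a buffer of length \<open>l\<close> makes the
  next block independent of it.
\<close>

lemma survive_block_le:
  assumes "0 \<le> t" "0 < L"
  shows "prob (survive (t + l + L)) \<le> prob (survive t) * (1 - prob (gap_in (t + l) (t + l + L)))"
proof -
  let ?B = "gap_in (t + l) (t + l + L)"
  interpret H: sigma_algebra "space P" "history {t + l<..<t + l + L + l}" by (rule history_sigma_algebra)
  have B: "?B \<in> history {t + l<..<t + l + L + l}" using assms l_pos by (intro gap_in_event) auto
  have "survive (t + l + L) \<subseteq> survive t \<inter> (space P - ?B)"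
    using survive_step[of t "t + l"] survive_step[of "t + l" "t + l + L"] assms l_pos
    by (auto simp: survive_def)
  then have "prob (survive (t + l + L)) \<le> prob (survive t \<inter> (space P - ?B))"
    using survive_events[of t] history_events[OF B] assms by (intro finite_measure_mono) auto
  also have "\<dots> = prob (survive t) * prob (space P - ?B)"
    by (rule prob_history_Int[OF survive_event[OF assms(1)] H.compl_sets[OF B]]) auto
  also have "prob (space P - ?B) = 1 - prob ?B" by (rule prob_compl[OF history_events[OF B]])
  finally show ?thesis .
qed

lemma survive_le_exp:
  assumes "0 \<le> T" "0 < L"
  shows "prob (survive (T + real k * (l + L))) \<le>
    exp (- (\<Sum>j<k. prob (gap_in (T + real j * (l + L) + l) (T + real j * (l + L) + l + L))))"
proof (induction k)
  case 0
  then show ?case by simp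
next
  case (Suc k)
  define t where "t = T + real k * (l + L)"
  let ?\<beta> = "prob (gap_in (t + l) (t + l + L))"
  have t: "0 \<le> t" using assms l_pos by (simp add: t_def)
  have "prob (survive (t + l + L)) \<le> prob (survive t) * (1 - ?\<beta>)"
    by (rule survive_block_le[OF t assms(2)])
  also have "\<dots> \<le> exp (- (\<Sum>j<k. prob (gap_in (T + real j * (l + L) + l) (T + real j * (l + L) + l + L)))) * exp (- ?\<beta>)"
    using Suc exp_ge_add_one_self[of "- ?\<beta>"] unfolding t_def by (intro mult_mono) auto
  finally show ?case by (simp add: t_def algebra_simps exp_add[symmetric])
qed

text \<open>
  With cells of half the critical length, a point in each cell has another point at distance less
  than \<open>l\<close> in the next cell.
\<close>

definition cover :: "nat \<Rightarrow> 'w set" where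
  "cover n = {\<omega>\<in>space P. \<forall>k<n. N \<omega> \<inter> {real k * (l / 2)<..real (Suc k) * (l / 2)} \<noteq> {}}"

lemma cover_Suc: "cover (Suc n) = cover n \<inter> hit {real n * (l / 2)<..real (Suc n) * (l / 2)}"
  by (auto simp: cover_def hit_def less_Suc_eq)

lemma cell_bounded_sets:
  "{real n * (l / 2)<..real (Suc n) * (l / 2)} \<in> bounded_sets {real n * (l / 2)<..real (Suc n) * (l / 2)}"
proof (intro bounded_setsI[where u = "real (Suc n) * (l / 2) + 1"])
  have "0 \<le> real n * (l / 2)" using l_pos by simp
  then show "{real n * (l / 2)<..real (Suc n) * (l / 2)} \<subseteq> {0<..<real (Suc n) * (l / 2) + 1}" by auto
qed auto

lemma cover_event: "cover n \<in> history {0<..real n * (l / 2)}"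
proof (induction n)
  case 0
  interpret H: sigma_algebra "space P" "history {0<..real 0 * (l / 2)}" by (rule history_sigma_algebra)
  have "cover 0 = space P" by (auto simp: cover_def)
  then show ?case using H.top by simp
next
  case (Suc n)
  let ?I = "{0<..real (Suc n) * (l / 2)}"
  interpret H: sigma_algebra "space P" "history ?I" by (rule history_sigma_algebra)
  have n: "0 \<le> real n * (l / 2)" "real n * (l / 2) \<le> real (Suc n) * (l / 2)"
    using l_pos by auto
  have "history {0<..real n * (l / 2)} \<subseteq> history ?I" by (rule history_mono) (use n in auto)
  then have "cover n \<in> history ?I" using Suc by blast
  moreover have "hit {real n * (l / 2)<..real (Suc n) * (l / 2)} \<in> history ?I"
    by (intro hit_history bounded_sets_mono[OF _ cell_bounded_sets]) (use n in auto)
  ultimately show ?case unfolding cover_Suc by (rule H.Int)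
qed

lemma prob_cover_Suc:
  "prob (cover (Suc n)) = prob (cover n) * (1 - exp (- mass {real n * (l / 2)<..real (Suc n) * (l / 2)}))"
  unfolding cover_Suc prob_hit[OF cell_bounded_sets, symmetric]
  by (rule prob_history_Int[OF cover_event hit_history[OF cell_bounded_sets]]) auto

lemma prob_cover_pos:
  assumes "AE t in lborel. 0 \<le> t \<longrightarrow> 0 < \<mu> t"
  shows "0 < prob (cover n)"
proof (induction n)
  case 0
  have "cover 0 = space P" by (auto simp: cover_def)
  then show ?case by (simp add: prob_space)
next
  case (Suc n)
  have "0 < mass {real n * (l / 2)<..real (Suc n) * (l / 2)}"
    using l_pos by (intro mass_pos[OF assms]) auto
  then show ?case using Suc by (simp add: prob_cover_Suc)
qed

lemma cover_survive: "cover (Suc n) \<subseteq> survive (real n * (l / 2))"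
proof
  fix \<omega> assume cov: "\<omega> \<in> cover (Suc n)"
  define u where "u = (\<lambda>k. real k * (l / 2))"
  have u: "u 0 = 0" "u (Suc k) = u k + l / 2" for k by (auto simp: u_def algebra_simps)
  have sp: "\<omega> \<in> space P" using cov by (simp add: cover_def)
  have c: "\<exists>q\<in>N \<omega>. u k < q \<and> q \<le> u k + l / 2" if "k < Suc n" for k
  proof -
    have "N \<omega> \<inter> {u k<..u (Suc k)} \<noteq> {}" using cov that unfolding cover_def u_def by blast
    then show ?thesis by (auto simp: u)
  qed
  obtain q where "q \<in> N \<omega>" "0 < q" "q \<le> l / 2" using c[of 0] u by auto
  then have "q \<in> N \<omega> \<inter> {0<..<l}" using l_pos by simp
  then have "\<omega> \<in> hit {0<..<l}" using sp by (auto simp: hit_def)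
  moreover have "\<omega> \<notin> gap_in 0 (u n)"
  proof
    assume "\<omega> \<in> gap_in 0 (u n)"
    then obtain s where s: "s \<in> N \<omega>" "0 < s" "s \<le> u n" "N \<omega> \<inter> {s<..<s + l} = {}"
      by (auto simp: gap_in_def)
    have "s \<le> 0 + l / 2 * real n" using s(3) by (simp add: u_def mult.commute)
    from grid_cell[OF s(2) this] obtain k where k: "k < n" "u k < s" "s \<le> u (Suc k)"
      unfolding u_def mult.commute[of "l / 2"] by auto
    obtain q where "q \<in> N \<omega>" "u (Suc k) < q" "q \<le> u (Suc k) + l / 2"
      using c[of "Suc k"] k(1) by auto
    then have "q \<in> N \<omega> \<inter> {s<..<s + l}" using k u(2)[of k] by simp
    then show False using s(4) by blast
  qed
  moreover have "0 \<le> real n * (l / 2)" using l_pos by simp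
  ultimately show "\<omega> \<in> survive (real n * (l / 2))" by (simp add: survive_eq u_def)
qed

text \<open>
  If \<open>D\<close> falls into \<open>(t, t + l]\<close>, then \<open>D > t - l\<close> and a long gap starts in \<open>(t, t + l]\<close>. Weakening \<open>D > t\<close>
  to \<open>D > t - l\<close> makes the first event depend only on the points up to \<open>t\<close>, hence independent of the
  second.
\<close>

lemma cover_survive_step:
  assumes t: "l \<le> t" "real n * (l / 2) \<le> t"
  shows "prob (cover n \<inter> survive t) - prob (gap_in t (t + l)) * prob (cover n \<inter> survive (t - l))
    \<le> prob (cover n \<inter> survive (t + l))"
proof -
  let ?A = "cover n \<inter> survive (t - l)" and ?B = "gap_in t (t + l)"
  interpret H: sigma_algebra "space P" "history {0<..t}" by (rule history_sigma_algebra)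
  have "history {0<..real n * (l / 2)} \<subseteq> history {0<..t}" by (rule history_mono) (use t in auto)
  then have "cover n \<in> history {0<..t}" using cover_event by blast
  moreover have "history {0<..<t - l + l} \<subseteq> history {0<..t}" by (rule history_mono) auto
  then have "survive (t - l) \<in> history {0<..t}" using survive_event[of "t - l"] t by auto
  ultimately have A: "?A \<in> history {0<..t}" by (rule H.Int)
  have t0: "0 \<le> t" using t l_pos by simp
  have B: "?B \<in> history {t<..<t + l + l}" using gap_in_event[OF t0] .
  have ce: "cover n \<in> events" using history_events[OF cover_event] .
  have "cover n \<inter> survive t \<subseteq> (cover n \<inter> survive (t + l)) \<union> (?A \<inter> ?B)"
    using survive_step[of t "t + l"] survive_step[of "t - l" t] t l_pos by auto
  then have "prob (cover n \<inter> survive t) \<le> prob ((cover n \<inter> survive (t + l)) \<union> (?A \<inter> ?B))"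
    using ce survive_events t t0 l_pos history_events[OF A] history_events[OF B]
    by (intro finite_measure_mono) auto
  also have "\<dots> \<le> prob (cover n \<inter> survive (t + l)) + prob (?A \<inter> ?B)"
    using ce survive_events t t0 l_pos history_events[OF A] history_events[OF B]
    by (intro measure_Un_le) auto
  also have "prob (?A \<inter> ?B) = prob ?A * prob ?B" by (rule prob_history_Int[OF A B]) auto
  finally show ?thesis by (simp add: mult.commute)
qed

text \<open>
  The recursion is run for \<open>D > t\<close> together with the covering of \<open>(0, t0]\<close>. Before \<open>t0\<close> the covering
  alone implies survival up to \<open>t0 - l\<close>, and hitting one more cell gives survival up to \<open>t0\<close>. The
  first ratio is therefore at least the probability of hitting that cell.
\<close>

lemma survive_ge_exp:
  assumes \<eta>: "0 < \<eta>" "\<eta> < 1" and n: "2 \<le> n" and t0: "t0 = real n * (l / 2)"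
    and small: "\<And>k. prob (gap_in (t0 + real k * l) (t0 + real k * l + l)) \<le> \<eta> * (1 - \<eta>)"
    and cell: "exp (- mass {real n * (l / 2)<..real (Suc n) * (l / 2)}) \<le> \<eta>"
  shows "(1 - \<eta>) * prob (cover n) *
      exp (- ((\<Sum>j<k. prob (gap_in (t0 + real j * l) (t0 + real j * l + l))) / (1 - \<eta>)\<^sup>2))
    \<le> prob (survive (t0 + real k * l))"
proof -
  \<comment> \<open>The shift by \<open>l\<close> makes \<open>w 0\<close> the probability of the covering itself.\<close>
  define w where "w = (\<lambda>k. prob (cover n \<inter> survive (t0 + real k * l - l)))"
  have t0l: "l \<le> t0" using n l_pos unfolding t0 by (simp add: field_simps)
  have ce: "cover n \<in> events" using history_events[OF cover_event] .
  obtain n' where n': "n = Suc n'" using n by (cases n) auto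
  have "cover n \<subseteq> survive (real n' * (l / 2))" unfolding n' by (rule cover_survive)
  also have "\<dots> \<subseteq> survive (t0 - l)"
    using survive_step[of "t0 - l" "real n' * (l / 2)"] t0l l_pos unfolding t0 n' by (auto simp: algebra_simps)
  finally have w0: "w 0 = prob (cover n)" by (simp add: w_def Int_absorb2)
  have w1: "(1 - \<eta>) * w 0 \<le> w 1"
  proof -
    have "(1 - \<eta>) * w 0 \<le> prob (cover (Suc n))"
      unfolding w0 prob_cover_Suc using cell by (subst mult.commute) (auto intro!: mult_left_mono)
    also have "\<dots> \<le> prob (cover n \<inter> survive t0)"
      using cover_survive[of n] ce survive_events[of t0] t0l l_pos unfolding t0
      by (intro finite_measure_mono) (auto simp: cover_Suc)
    finally show ?thesis by (simp add: w_def)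
  qed
  have rec: "w (Suc k) - prob (gap_in (t0 + real k * l) (t0 + real k * l + l)) * w k \<le> w (Suc (Suc k))" for k
  proof -
    have "0 \<le> real k * l" using l_pos by simp
    then have "l \<le> t0 + real k * l" "real n * (l / 2) \<le> t0 + real k * l" using t0l t0 by auto
    from cover_survive_step[OF this] show ?thesis by (simp add: w_def algebra_simps)
  qed
  have "(1 - \<eta>) * w 0 * exp (- ((\<Sum>j<k. prob (gap_in (t0 + real j * l) (t0 + real j * l + l))) / (1 - \<eta>)\<^sup>2)) \<le> w (Suc k)"
    by (rule delayed_recursion_lower_bound[OF \<eta> _ w1 rec _ small]) (auto simp: w_def)
  also have "\<dots> \<le> prob (survive (t0 + real k * l))"
    using survive_events[of "t0 + real k * l"] t0l l_pos
    by (auto simp: w_def algebra_simps intro!: finite_measure_mono)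
  finally show ?thesis unfolding w0 .
qed

end

section \<open>Slowly varying intensities\<close>

lemma sum_increments_ge:
  fixes p :: "nat \<Rightarrow> real"
  assumes "\<And>j. q * (G (x (Suc j)) - G (x j)) \<le> p j"
  shows "q * (G (x k) - G (x 0)) \<le> (\<Sum>j<k. p j)"
proof (induction k)
  case (Suc k)
  then show ?case using assms[of k] by (simp add: algebra_simps)
qed simp

text \<open>
  The intensity agrees with \<open>m\<close> at late times only, and \<open>G\<close> plays the role of a primitive of
  \<open>m exp (- l m)\<close>. This role is expressed by increments over fixed distances, which is what telescopes
  and which can be read off from an explicit formula.
\<close>

locale slow_intensity = poisson_gaps P N \<mu> l
  for P :: "'w measure" and N \<mu> l +
  fixes m G :: "real \<Rightarrow> real" and S :: real
  assumes intensity_pos: "AE t in lborel. 0 \<le> t \<longrightarrow> 0 < \<mu> t"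
    and intensity_eq: "\<forall>\<^sub>F t in at_top. \<mu> t = m t"
    and m_mono: "mono_on {S..} m"
    and m_at_top: "filterlim m at_top at_top"
    and m_slow: "\<And>c. 0 < c \<Longrightarrow> ((\<lambda>t. m (t + c) - m t) \<longlongrightarrow> 0) at_top"
    and G_mono: "mono_on {S..} G"
    and G_at_top: "filterlim G at_top at_top"
    and G_increment: "\<And>c. 0 < c \<Longrightarrow>
      ((\<lambda>t. (G (t + c) - G t) / (c * m t * exp (- (l * m t)))) \<longlongrightarrow> 1) at_top"
begin

lemma eventually_intensity_between:
  "\<forall>\<^sub>F t in at_top. 0 \<le> t \<and> 0 < m t \<and> (\<forall>s c. t < s \<longrightarrow> s < t + c \<longrightarrow> m t \<le> \<mu> s \<and> \<mu> s \<le> m (t + c))"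
proof -
  obtain T where T: "\<And>t. T \<le> t \<Longrightarrow> \<mu> t = m t"
    using intensity_eq by (auto simp: eventually_at_top_linorder)
  have "\<forall>\<^sub>F t in at_top. 0 < m t" using m_at_top by (simp add: filterlim_at_top_dense)
  then show ?thesis using eventually_ge_at_top[of T] eventually_ge_at_top[of S] eventually_ge_at_top[of 0]
  proof eventually_elim
    case (elim t)
    have "m t \<le> \<mu> s \<and> \<mu> s \<le> m (t + c)" if "t < s" "s < t + c" for s c
    proof -
      have "\<mu> s = m s" using T that elim by simp
      moreover have "m t \<le> m s" "m s \<le> m (t + c)"
        by (rule mono_onD[OF m_mono]; use that elim in simp)+
      ultimately show ?thesis by simp
    qed
    then show ?case using elim by blast
  qed
qed

lemma increment_small:
  assumes "0 < c"
  shows "((\<lambda>t. G (t + c) - G t) \<longlongrightarrow> 0) at_top"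
proof -
  have "((\<lambda>x. c * x * exp (- (l * x))) \<longlongrightarrow> 0) at_top" using l_pos by real_asymp
  from filterlim_compose[OF this m_at_top]
  have "((\<lambda>t. (G (t + c) - G t) / (c * m t * exp (- (l * m t))) * (c * m t * exp (- (l * m t)))) \<longlongrightarrow> 1 * 0) at_top"
    by (intro tendsto_mult G_increment assms)
  moreover have "\<forall>\<^sub>F t in at_top. 0 < m t" using m_at_top by (simp add: filterlim_at_top_dense)
  then have "\<forall>\<^sub>F t in at_top. (G (t + c) - G t) / (c * m t * exp (- (l * m t))) * (c * m t * exp (- (l * m t))) = G (t + c) - G t"
    by eventually_elim (use assms in auto)
  ultimately show ?thesis by (subst (asm) filterlim_cong[OF refl refl]) auto
qed

lemma increment_pos:
  assumes "0 < c"
  shows "\<forall>\<^sub>F t in at_top. 0 < G (t + c) - G t"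
proof -
  have "\<forall>\<^sub>F t in at_top. 0 < (G (t + c) - G t) / (c * m t * exp (- (l * m t)))"
    by (rule order_tendstoD(1)[OF G_increment[OF assms]]) simp
  moreover have "\<forall>\<^sub>F t in at_top. 0 < m t" using m_at_top by (simp add: filterlim_at_top_dense)
  ultimately show ?thesis
    by eventually_elim (use assms in \<open>auto simp: zero_less_divide_iff zero_less_mult_iff mult_less_0_iff\<close>)
qed

lemma gap_in_le_increment:
  assumes "1 < \<epsilon>"
  shows "\<forall>\<^sub>F t in at_top. prob (gap_in t (t + l)) \<le> \<epsilon> * (G (t + l) - G t)"
proof -
  define r where "r = (\<lambda>t. l * m (t + 2 * l) * exp (- (l * m t)) / (G (t + l) - G t))"
  have m_pos: "\<forall>\<^sub>F t in at_top. 0 < m t" using m_at_top by (simp add: filterlim_at_top_dense)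
  have "((\<lambda>t. (1 + (m (t + 2 * l) - m t) / m t) / ((G (t + l) - G t) / (l * m t * exp (- (l * m t))))) \<longlongrightarrow> (1 + 0) / 1) at_top"
    by (intro tendsto_divide tendsto_add tendsto_const G_increment l_pos
        tendsto_divide_0[OF m_slow] filterlim_at_top_imp_at_infinity m_at_top) (use l_pos in auto)
  moreover have "\<forall>\<^sub>F t in at_top. (1 + (m (t + 2 * l) - m t) / m t) / ((G (t + l) - G t) / (l * m t * exp (- (l * m t)))) = r t"
    using m_pos by eventually_elim (simp add: r_def field_simps)
  ultimately have "(r \<longlongrightarrow> 1) at_top" by (subst (asm) filterlim_cong[OF refl refl]) auto
  then have "\<forall>\<^sub>F t in at_top. r t < \<epsilon>" using assms by (intro order_tendstoD(2)) auto
  with increment_pos[OF l_pos] eventually_intensity_between show ?thesis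
  proof eventually_elim
    case (elim t)
    have "prob (gap_in t (t + l)) \<le> (t + l - t) * m (t + 2 * l) * exp (- (l * m t))"
    proof (rule prob_gap_in_le)
      fix s assume "t < s" "s < t + l + l"
      then have "t < s" "s < t + 2 * l" by auto
      then show "m t \<le> \<mu> s \<and> \<mu> s \<le> m (t + 2 * l)" using elim by blast
    qed (use elim l_pos in auto)
    also have "\<dots> = r t * (G (t + l) - G t)" using elim by (simp add: r_def)
    also have "\<dots> \<le> \<epsilon> * (G (t + l) - G t)" using elim by (intro mult_right_mono) auto
    finally show ?case .
  qed
qed

text \<open>
  With \<open>n\<close> cells in the block, the main term of \<open>prob_gap_in_ge\<close> needs \<open>m / n\<close> to tend to \<open>0\<close> and
  the pair term needs \<open>n\<^sup>2 exp (- l m)\<close> to tend to \<open>0\<close>. Taking \<open>n\<close> of order \<open>m\<^sup>2\<close> satisfies both.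
  The constant \<open>L / (l + L)\<close> is the share of the block in the step from \<open>t\<close> to \<open>t + (l + L)\<close>.
\<close>

lemma gap_in_ge_increment:
  assumes L: "0 < L" and q: "q < L / (l + L)"
  shows "\<forall>\<^sub>F t in at_top. q * (G (t + (l + L)) - G t) \<le> prob (gap_in (t + l) (t + l + L))"
proof -
  \<comment> \<open>\<open>B\<close> is the lower bound of \<open>prob_gap_in_ge\<close> after \<open>m\<^sup>2 \<le> n \<le> (m + 1)\<^sup>2\<close> is inserted.\<close>
  define B where "B = (\<lambda>t. (L * m t - L\<^sup>2) * exp (- (l * m (t + (2 * l + L)))) - (m t + 1) ^ 4 * exp (- (2 * l * m t)))"
  define g where "g = (\<lambda>t. L * m t * exp (- (l * m t)))"
  have m_pos: "\<forall>\<^sub>F t in at_top. 0 < m t" using m_at_top by (simp add: filterlim_at_top_dense)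
  have c: "0 < 2 * l + L" "0 < l + L" using l_pos L by auto
  have "((\<lambda>x. 1 - L / x) \<longlongrightarrow> 1) at_top" "((\<lambda>x. (x + 1) ^ 4 * exp (- (l * x)) / (L * x)) \<longlongrightarrow> 0) at_top"
    using l_pos L by real_asymp+
  note lims = this[THEN filterlim_compose[OF _ m_at_top]]
  have "((\<lambda>t. (1 - L / m t) * exp (- (l * (m (t + (2 * l + L)) - m t))) - (m t + 1) ^ 4 * exp (- (l * m t)) / (L * m t))
    \<longlongrightarrow> 1 * exp (- (l * 0)) - 0) at_top"
    by (intro tendsto_intros lims m_slow c)
  moreover have "\<forall>\<^sub>F t in at_top. (1 - L / m t) * exp (- (l * (m (t + (2 * l + L)) - m t))) - (m t + 1) ^ 4 * exp (- (l * m t)) / (L * m t) = B t / g t"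
    using m_pos
  proof eventually_elim
    case (elim t)
    have "exp (- (l * (m (t + (2 * l + L)) - m t))) = exp (- (l * m (t + (2 * l + L)))) / exp (- (l * m t))"
      by (simp add: exp_diff[symmetric] algebra_simps)
    moreover have "exp (- (2 * l * m t)) = exp (- (l * m t)) * exp (- (l * m t))"
      by (simp add: exp_add[symmetric])
    ultimately show ?case using elim L
      by (simp add: B_def g_def diff_divide_distrib power2_eq_square) (simp add: field_simps)
  qed
  ultimately have Bg: "((\<lambda>t. B t / g t) \<longlongrightarrow> 1) at_top"
    by (subst (asm) filterlim_cong[OF refl refl]) auto
  have "((\<lambda>t. L / (l + L) * (B t / g t / ((G (t + (l + L)) - G t) / ((l + L) * m t * exp (- (l * m t)))))) \<longlongrightarrow> L / (l + L) * (1 / 1)) at_top"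
    by (intro tendsto_mult tendsto_const tendsto_divide Bg G_increment c) auto
  moreover have "\<forall>\<^sub>F t in at_top. L / (l + L) * (B t / g t / ((G (t + (l + L)) - G t) / ((l + L) * m t * exp (- (l * m t))))) = B t / (G (t + (l + L)) - G t)"
    using m_pos by eventually_elim (use L c in \<open>simp add: g_def\<close>)
  ultimately have "((\<lambda>t. B t / (G (t + (l + L)) - G t)) \<longlongrightarrow> L / (l + L)) at_top"
    by (subst (asm) filterlim_cong[OF refl refl]) auto
  then have "\<forall>\<^sub>F t in at_top. q < B t / (G (t + (l + L)) - G t)" using q by (intro order_tendstoD(1)) auto
  moreover have "\<forall>\<^sub>F t in at_top. L < m t" using m_at_top by (simp add: filterlim_at_top_dense)
  ultimately show ?thesis using increment_pos[OF c(2)] eventually_intensity_between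
  proof eventually_elim
    case (elim t)
    define n where "n = (nat \<lceil>m t\<rceil>)\<^sup>2"
    have mt: "0 < m t" using elim by blast
    have c1: "m t \<le> real (nat \<lceil>m t\<rceil>)" "real (nat \<lceil>m t\<rceil>) \<le> m t + 1" using mt by linarith+
    have n1: "(m t)\<^sup>2 \<le> real n" "real n \<le> (m t + 1)\<^sup>2"
      unfolding n_def of_nat_power using c1 mt by (auto intro: power_mono)
    have n0: "0 < n" using n1(1) mt by (cases n) auto
    define z where "z = L / real n * m t"
    have z: "0 < z" using L n0 mt by (simp add: z_def)
    have "real n * (z - z\<^sup>2) \<le> real n * (1 - exp (- z))"
    proof (intro mult_left_mono)
      have "exp (- z) * (1 + z) \<le> exp (- z) * exp z" using exp_ge_add_one_self[of z] by (intro mult_left_mono) auto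
      then have "exp (- z) * (1 + z) \<le> 1" by (simp add: exp_minus)
      also have "1 \<le> (1 - z + z\<^sup>2) * (1 + z)" using z by (simp add: algebra_simps power2_eq_square)
      finally have "exp (- z) \<le> 1 - z + z\<^sup>2" using z by (simp add: mult_le_cancel_right)
      then show "z - z\<^sup>2 \<le> 1 - exp (- z)" by simp
    qed auto
    moreover have "real n * (z - z\<^sup>2) = L * m t - L\<^sup>2 * ((m t)\<^sup>2 / real n)"
      using n0 by (simp add: z_def power2_eq_square field_simps)
    moreover have "L\<^sup>2 * ((m t)\<^sup>2 / real n) \<le> L\<^sup>2 * 1"
      using n1(1) n0 by (intro mult_left_mono) auto
    ultimately have 1: "L * m t - L\<^sup>2 \<le> real n * (1 - exp (- z))" by simp
    have "(real n)\<^sup>2 \<le> ((m t + 1)\<^sup>2)\<^sup>2" using n1 by (intro power_mono) auto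
    then have 2: "(real n)\<^sup>2 \<le> (m t + 1) ^ 4" by simp
    have "q * (G (t + (l + L)) - G t) \<le> B t" using elim by (simp add: field_simps)
    also have "B t \<le> real n * (1 - exp (- z)) * exp (- (l * m (t + (2 * l + L)))) - (real n)\<^sup>2 * exp (- (2 * l * m t))"
      unfolding B_def using 1 2 by (intro diff_mono mult_right_mono) auto
    also have "\<dots> \<le> prob (gap_in (t + l) (t + l + L))"
      unfolding mult.assoc
    proof -
      have "real n * ((1 - exp (- ((t + l + L - (t + l)) / real n * m t))) * exp (- (l * m (t + (2 * l + L))))) - (real n)\<^sup>2 * exp (- (2 * l * m t))
        \<le> prob (gap_in (t + l) (t + l + L))"
      proof (rule prob_gap_in_ge)
        fix s assume "t + l < s" "s < t + l + L + l"
        then have "t < s" "s < t + (2 * l + L)" using l_pos by auto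
        then show "m t \<le> \<mu> s \<and> \<mu> s \<le> m (t + (2 * l + L))" using elim by blast
      qed (use elim l_pos L n0 in auto)
      then show "real n * ((1 - exp (- z)) * exp (- (l * m (t + (2 * l + L))))) - (real n)\<^sup>2 * exp (- (2 * (l * m t)))
        \<le> prob (gap_in (t + l) (t + l + L))" by (simp add: z_def mult.assoc)
    qed
    finally show ?case .
  qed
qed

text \<open>
  Given \<open>q < 1\<close>, the blocks are chosen so long that their share \<open>L / (l + L)\<close> exceeds \<open>q\<close>. A general
  time lies between two block ends, and this costs only a bounded term since a single increment of
  \<open>G\<close> is at most \<open>1\<close>.
\<close>

lemma survive_eventually_le:
  assumes q: "0 < q" "q < 1"
  shows "\<exists>C. \<forall>\<^sub>F t in at_top. prob (survive t) \<le> exp (C - q * G t)"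
proof -
  obtain r where r: "q < r" "r < 1" using dense[OF q(2)] by blast
  \<comment> \<open>This solves \<open>L / (l + L) = r\<close>.\<close>
  define L where "L = l * r / (1 - r)"
  have L: "0 < L" using r q l_pos by (simp add: L_def)
  have "l + L = l / (1 - r)" using r by (simp add: L_def field_simps)
  then have "L / (l + L) = r" using r l_pos by (simp add: L_def)
  then have "q < L / (l + L)" using r by simp
  then have "\<forall>\<^sub>F t in at_top. q * (G (t + (l + L)) - G t) \<le> prob (gap_in (t + l) (t + l + L))"
    by (rule gap_in_ge_increment[OF L])
  moreover have "\<forall>\<^sub>F t in at_top. G (t + (l + L)) - G t < 1"
    using L l_pos by (intro order_tendstoD(2)[OF increment_small]) auto
  ultimately have "\<forall>\<^sub>F t in at_top. q * (G (t + (l + L)) - G t) \<le> prob (gap_in (t + l) (t + l + L)) \<and>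
    G (t + (l + L)) - G t < 1 \<and> max 0 S \<le> t"
    using eventually_ge_at_top[of "max 0 S"] by eventually_elim blast
  then obtain T where T: "\<And>t. T \<le> t \<Longrightarrow> q * (G (t + (l + L)) - G t) \<le> prob (gap_in (t + l) (t + l + L))"
    "\<And>t. T \<le> t \<Longrightarrow> G (t + (l + L)) - G t < 1" "0 \<le> T" "S \<le> T"
    unfolding eventually_at_top_linorder by (metis max.bounded_iff order_refl)
  define c where "c = l + L"
  have c: "0 < c" using L l_pos by (simp add: c_def)
  have "prob (survive t) \<le> exp (q * (G T + 1) - q * G t)" if t: "T \<le> t" for t
  proof -
    define k where "k = nat \<lfloor>(t - T) / c\<rfloor>"
    have "real k \<le> (t - T) / c" "(t - T) / c < real k + 1"
      unfolding k_def using t c by (auto simp: le_nat_iff intro!: of_nat_floor)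
    then have k: "T + real k * c \<le> t" "t \<le> T + real k * c + c"
      using c by (auto simp: field_simps)
    have kc: "0 \<le> real k * c" using c by simp
    have "q * (G (T + real k * c) - G (T + real 0 * c)) \<le>
      (\<Sum>j<k. prob (gap_in (T + real j * c + l) (T + real j * c + l + L)))"
    proof (rule sum_increments_ge[where x = "\<lambda>j. T + real j * c"])
      fix j
      have "T \<le> T + real j * c" using c by simp
      from T(1)[OF this] show "q * (G (T + real (Suc j) * c) - G (T + real j * c)) \<le>
        prob (gap_in (T + real j * c + l) (T + real j * c + l + L))"
        by (simp add: c_def algebra_simps)
    qed
    moreover have "G t \<le> G (T + real k * c + c)"
      by (rule mono_onD[OF G_mono]) (use T t k in auto)
    moreover have "G (T + real k * c + c) < G (T + real k * c) + 1"
      using T(2)[of "T + real k * c"] kc by (simp add: c_def)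
    ultimately have *: "q * (G (T + real k * c) - G T) \<le> (\<Sum>j<k. prob (gap_in (T + real j * c + l) (T + real j * c + l + L)))"
      and "G t - 1 - G T \<le> G (T + real k * c) - G T" by auto
    from this(2) have "q * (G t - 1 - G T) \<le> q * (G (T + real k * c) - G T)"
      using q by (intro mult_left_mono) auto
    with * have "q * (G t - 1 - G T) \<le> (\<Sum>j<k. prob (gap_in (T + real j * c + l) (T + real j * c + l + L)))"
      by linarith
    then have "exp (- (\<Sum>j<k. prob (gap_in (T + real j * c + l) (T + real j * c + l + L)))) \<le> exp (q * (G T + 1) - q * G t)"
      by (simp add: algebra_simps)
    moreover have "prob (survive (T + real k * c)) \<le> exp (- (\<Sum>j<k. prob (gap_in (T + real j * c + l) (T + real j * c + l + L))))"
      unfolding c_def by (rule survive_le_exp[OF T(3) L])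
    moreover have "prob (survive t) \<le> prob (survive (T + real k * c))"
      using k kc T(3) by (intro survive_antimono) auto
    ultimately show ?thesis by linarith
  qed
  then show ?thesis unfolding eventually_at_top_linorder by blast
qed

text \<open>
  The losses in \<open>survive_ge_exp\<close> and \<open>gap_in_le_increment\<close> combine to a factor
  \<open>(1 + \<eta>) / (1 - \<eta>)\<^sup>2\<close> in the exponent, which is below \<open>\<kappa>\<close> for small \<open>\<eta>\<close>. The starting
  time \<open>t0\<close> is a multiple of \<open>l / 2\<close> after which all asymptotic estimates hold.
\<close>

lemma survive_eventually_ge:
  assumes \<kappa>: "1 < \<kappa>"
  shows "\<exists>C. \<forall>\<^sub>F t in at_top. exp (C - \<kappa> * G t) \<le> prob (survive t)"
proof -
  have "((\<lambda>\<eta>::real. (1 + \<eta>) / (1 - \<eta>)\<^sup>2) \<longlongrightarrow> (1 + 0) / (1 - 0)\<^sup>2) (at_right 0)"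
    by (intro tendsto_intros) auto
  then have "\<forall>\<^sub>F \<eta> in at_right 0. (1 + \<eta>) / (1 - \<eta>)\<^sup>2 < \<kappa>"
    by (rule order_tendstoD(2)) (use \<kappa> in simp)
  moreover have "\<forall>\<^sub>F \<eta> in at_right 0. \<eta> \<in> {0<..<(1::real)}" by (rule eventually_at_right_real) simp
  ultimately obtain \<eta> :: real where \<eta>: "0 < \<eta>" "\<eta> < 1" "(1 + \<eta>) / (1 - \<eta>)\<^sup>2 < \<kappa>"
    using eventually_happens'[OF trivial_limit_at_right_real eventually_conj] by (metis (no_types, lifting) greaterThanLessThan_iff)
  \<comment> \<open>Increments of \<open>G\<close> below \<open>\<delta>\<close> keep the gap probabilities below \<open>\<eta> (1 - \<eta>)\<close>.\<close>
  define \<delta> where "\<delta> = \<eta> * (1 - \<eta>) / (1 + \<eta>)"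
  have \<delta>: "0 < \<delta>" using \<eta> by (simp add: \<delta>_def)
  have "\<forall>\<^sub>F t in at_top. 2 / l * (- ln \<eta>) < m t" using m_at_top by (simp add: filterlim_at_top_dense)
  moreover have "\<forall>\<^sub>F t in at_top. prob (gap_in t (t + l)) \<le> (1 + \<eta>) * (G (t + l) - G t)"
    using \<eta> by (intro gap_in_le_increment) simp
  moreover have "\<forall>\<^sub>F t in at_top. G (t + l) - G t < min 1 \<delta>"
    using \<delta> by (intro order_tendstoD(2)[OF increment_small[OF l_pos]]) simp
  ultimately have "\<forall>\<^sub>F t in at_top. prob (gap_in t (t + l)) \<le> (1 + \<eta>) * (G (t + l) - G t) \<and>
    G (t + l) - G t < min 1 \<delta> \<and> max l S \<le> t \<and> 2 / l * (- ln \<eta>) < m t \<and>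
    (0 \<le> t \<and> 0 < m t \<and> (\<forall>s c. t < s \<longrightarrow> s < t + c \<longrightarrow> m t \<le> \<mu> s \<and> \<mu> s \<le> m (t + c)))"
    using eventually_ge_at_top[of "max l S"] eventually_intensity_between
    by eventually_elim blast
  then obtain T where "\<forall>t\<ge>T. prob (gap_in t (t + l)) \<le> (1 + \<eta>) * (G (t + l) - G t) \<and>
    G (t + l) - G t < min 1 \<delta> \<and> max l S \<le> t \<and> 2 / l * (- ln \<eta>) < m t \<and>
    (0 \<le> t \<and> 0 < m t \<and> (\<forall>s c. t < s \<longrightarrow> s < t + c \<longrightarrow> m t \<le> \<mu> s \<and> \<mu> s \<le> m (t + c)))"
    unfolding eventually_at_top_linorder by blast
  then have T: "T \<le> t \<Longrightarrow> prob (gap_in t (t + l)) \<le> (1 + \<eta>) * (G (t + l) - G t)"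
    "T \<le> t \<Longrightarrow> G (t + l) - G t < min 1 \<delta>" "max l S \<le> T" "T \<le> t \<Longrightarrow> 2 / l * (- ln \<eta>) < m t"
    "T \<le> t \<Longrightarrow> t < s \<Longrightarrow> s < t + c \<Longrightarrow> m t \<le> \<mu> s \<and> \<mu> s \<le> m (t + c)"
    "T \<le> t \<Longrightarrow> 0 < m t" for t s c
    by blast+
  obtain n where "T / (l / 2) < real n" using reals_Archimedean2 by blast
  then have Tn: "T \<le> real n * (l / 2)" using l_pos by (simp add: field_simps)
  define t0 where "t0 = real n * (l / 2)"
  have t0: "T \<le> t0" "l \<le> t0" "S \<le> t0" using Tn T(3) by (auto simp: t0_def)
  have "real 2 * l \<le> real n * l" using t0(2) by (simp add: t0_def)
  then have n: "2 \<le> n" using l_pos by simp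
  have after: "T \<le> t0 + real k * l" for k
    using t0 l_pos by (intro add_increasing2) auto
  have cell: "exp (- mass {real n * (l / 2)<..real (Suc n) * (l / 2)}) \<le> \<eta>"
  proof -
    have "m t0 * measure lborel {real n * (l / 2)<..real (Suc n) * (l / 2)} \<le> mass {real n * (l / 2)<..real (Suc n) * (l / 2)}"
    proof (rule mass_bounds(1)[OF cell_bounded_sets, where hi = "m (t0 + l)"])
      fix s assume "s \<in> {real n * (l / 2)<..real (Suc n) * (l / 2)}"
      then have "t0 < s" "s < t0 + l" using l_pos by (auto simp: t0_def algebra_simps)
      then show "m t0 \<le> \<mu> s \<and> \<mu> s \<le> m (t0 + l)" using T(5) t0 by blast
    qed (use T(6)[OF t0(1)] in simp)
    also have "measure lborel {real n * (l / 2)<..real (Suc n) * (l / 2)} = l / 2"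
      using l_pos by (simp add: algebra_simps)
    finally have "- mass {real n * (l / 2)<..real (Suc n) * (l / 2)} \<le> ln \<eta>"
      using T(4)[OF t0(1)] l_pos by (simp add: field_simps)
    then have "exp (- mass {real n * (l / 2)<..real (Suc n) * (l / 2)}) \<le> exp (ln \<eta>)" by simp
    then show ?thesis using \<eta> by simp
  qed
  have small: "prob (gap_in (t0 + real k * l) (t0 + real k * l + l)) \<le> \<eta> * (1 - \<eta>)" for k
  proof -
    have "prob (gap_in (t0 + real k * l) (t0 + real k * l + l)) \<le> (1 + \<eta>) * (G (t0 + real k * l + l) - G (t0 + real k * l))"
      by (rule T(1)[OF after])
    also have "\<dots> \<le> (1 + \<eta>) * \<delta>" using T(2)[OF after[of k]] \<eta> by (intro mult_left_mono) auto
    also have "\<dots> = \<eta> * (1 - \<eta>)" using \<eta> by (simp add: \<delta>_def)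
    finally show ?thesis .
  qed
  define A where "A = (1 - \<eta>) * prob (cover n)"
  have A: "0 < A" using \<eta> prob_cover_pos[OF intensity_pos] by (simp add: A_def)
  have "exp (ln A - \<kappa> * (1 - G t0) - \<kappa> * G t) \<le> prob (survive t)" if t: "t0 \<le> t" for t
  proof -
    define k where "k = nat \<lceil>(t - t0) / l\<rceil>"
    have "0 \<le> (t - t0) / l" using t l_pos by simp
    then have "(t - t0) / l \<le> real k" "real k < (t - t0) / l + 1"
      unfolding k_def by linarith+
    then have k: "t \<le> t0 + real k * l" "t0 + real k * l \<le> t + l"
      using l_pos by (auto simp: field_simps)
    let ?p = "\<lambda>j. prob (gap_in (t0 + real j * l) (t0 + real j * l + l))"
    have "(- (1 + \<eta>)) * (G (t0 + real k * l) - G (t0 + real 0 * l)) \<le> (\<Sum>j<k. - ?p j)"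
    proof (rule sum_increments_ge[where x = "\<lambda>j. t0 + real j * l"])
      fix j
      show "(- (1 + \<eta>)) * (G (t0 + real (Suc j) * l) - G (t0 + real j * l)) \<le> - ?p j"
        using T(1)[OF after[of j]] by (simp add: algebra_simps)
    qed
    then have "(\<Sum>j<k. ?p j) \<le> (1 + \<eta>) * (G (t0 + real k * l) - G t0)" by (simp add: sum_negf algebra_simps)
    then have "(\<Sum>j<k. ?p j) / (1 - \<eta>)\<^sup>2 \<le> (1 + \<eta>) / (1 - \<eta>)\<^sup>2 * (G (t0 + real k * l) - G t0)"
      using \<eta> by (simp add: divide_right_mono)
    also have "\<dots> \<le> \<kappa> * (G (t0 + real k * l) - G t0)"
    proof (intro mult_right_mono)
      have "0 \<le> real k * l" using l_pos by simp
      then have "G t0 \<le> G (t0 + real k * l)" by (intro mono_onD[OF G_mono]) (use t0 in auto)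
      then show "0 \<le> G (t0 + real k * l) - G t0" by simp
    qed (use \<eta> in simp)
    also have "\<dots> \<le> \<kappa> * (1 + G t - G t0)"
    proof (intro mult_left_mono)
      have "G (t0 + real k * l) \<le> G (t + l)"
        by (rule mono_onD[OF G_mono]) (use t0 t k l_pos in auto)
      also have "\<dots> \<le> G t + 1" using T(2)[of t] t t0 by simp
      finally show "G (t0 + real k * l) - G t0 \<le> 1 + G t - G t0" by simp
    qed (use \<kappa> in simp)
    finally have sum: "(\<Sum>j<k. ?p j) / (1 - \<eta>)\<^sup>2 \<le> \<kappa> * (1 + G t - G t0)" .
    have "exp (ln A - \<kappa> * (1 - G t0) - \<kappa> * G t) = A * exp (- (\<kappa> * (1 + G t - G t0)))"
      using A by (simp add: exp_diff exp_minus algebra_simps exp_add divide_simps)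
    also have "\<dots> \<le> A * exp (- ((\<Sum>j<k. ?p j) / (1 - \<eta>)\<^sup>2))"
      using A sum by (intro mult_left_mono) auto
    also have "\<dots> \<le> prob (survive (t0 + real k * l))"
      unfolding A_def by (rule survive_ge_exp[OF \<eta>(1,2) n t0_def small cell])
    also have "\<dots> \<le> prob (survive t)"
      using k t t0 l_pos by (intro survive_antimono) auto
    finally show ?thesis .
  qed
  then show ?thesis unfolding eventually_at_top_linorder by blast
qed

text \<open>
  Constant factors in the two bounds disappear because \<open>G\<close> tends to infinity.
\<close>

theorem ln_survive_asymp: "((\<lambda>t. ln (prob (survive t)) / - G t) \<longlongrightarrow> 1) at_top"
proof -
  have G_pos: "\<forall>\<^sub>F t in at_top. 0 < G t" using G_at_top by (simp add: filterlim_at_top_dense)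
  obtain C0 where "\<forall>\<^sub>F t in at_top. exp (C0 - 2 * G t) \<le> prob (survive t)"
    using survive_eventually_ge[of 2] by auto
  then have pos: "\<forall>\<^sub>F t in at_top. 0 < prob (survive t)"
    by eventually_elim (auto intro: less_le_trans[OF exp_gt_zero])
  have const: "((\<lambda>t. q - C / G t) \<longlongrightarrow> q) at_top" for q C
  proof -
    have "((\<lambda>x. q - C / x) \<longlongrightarrow> q) at_top" by real_asymp
    from filterlim_compose[OF this G_at_top] show ?thesis .
  qed
  show ?thesis
  proof (rule order_tendstoI)
    fix a :: real assume "a < 1"
    then obtain q where q: "max a 0 < q" "q < 1" using dense[of "max a 0" 1] by auto
    then obtain C where C: "\<forall>\<^sub>F t in at_top. prob (survive t) \<le> exp (C - q * G t)"
      using survive_eventually_le[of q] by auto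
    have "\<forall>\<^sub>F t in at_top. a < q - C / G t" using q by (intro order_tendstoD(1)[OF const]) auto
    with C pos G_pos show "\<forall>\<^sub>F t in at_top. a < ln (prob (survive t)) / - G t"
    proof eventually_elim
      case (elim t)
      have "ln (prob (survive t)) \<le> C - q * G t"
        using elim(1,2) ln_mono[of "prob (survive t)" "exp (C - q * G t)"] by simp
      then have "q * G t - C \<le> - ln (prob (survive t))" by simp
      then have "(q * G t - C) / G t \<le> - ln (prob (survive t)) / G t"
        using elim(3) by (intro divide_right_mono) auto
      then have "q - C / G t \<le> ln (prob (survive t)) / - G t" using elim(3) by (simp add: diff_divide_distrib)
      then show ?case using elim by linarith
    qed
  next
    fix a :: real assume "1 < a"
    then obtain q where q: "1 < q" "q < a" using dense by blast
    then obtain C where C: "\<forall>\<^sub>F t in at_top. exp (C - q * G t) \<le> prob (survive t)"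
      using survive_eventually_ge[of q] by auto
    have "\<forall>\<^sub>F t in at_top. q - C / G t < a" using q by (intro order_tendstoD(2)[OF const]) auto
    with C pos G_pos show "\<forall>\<^sub>F t in at_top. ln (prob (survive t)) / - G t < a"
    proof eventually_elim
      case (elim t)
      have "C - q * G t \<le> ln (prob (survive t))" using elim by (simp add: ln_ge_iff)
      then have "- ln (prob (survive t)) \<le> q * G t - C" by simp
      then have "- ln (prob (survive t)) / G t \<le> (q * G t - C) / G t"
        using elim(3) by (intro divide_right_mono) auto
      then have "ln (prob (survive t)) / - G t \<le> q - C / G t" using elim(3) by (simp add: diff_divide_distrib)
      then show ?case using elim by linarith
    qed
  qed
qed

corollary survive_log_asymp_equiv:
  assumes "\<forall>\<^sub>F t in at_top. ln (g t) = - G t"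
  shows "(\<lambda>t. measure P {\<omega> \<in> space P. first_gap l (N \<omega>) > ereal t}) \<approx>\<^bsub>log\<^esub> g"
proof -
  have "\<forall>\<^sub>F t in at_top. ln (prob (survive t)) / - G t = ln (prob (survive t)) / ln (g t)"
    using assms by eventually_elim simp
  from filterlim_cong[OF refl refl this] ln_survive_asymp show ?thesis
    unfolding log_asymp_equiv_def survive_def by simp
qed

end

section \<open>The three intensities\<close>

text \<open>
  In terms of \<open>u = ln t\<close> the function is \<open>u - b ln u\<close>, and
  \<open>ln v - ln u \<le> (v - u) / u\<close> shows that it increases once \<open>u \<ge> b\<close>.
\<close>

lemma mono_on_log_minus_loglog:
  fixes b c :: real
  shows "mono_on {exp (max b 1)..} (\<lambda>t. ln t - b * ln (ln t) - c)"
proof (rule mono_onI)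
  fix s t :: real assume st: "s \<in> {exp (max b 1)..}" "t \<in> {exp (max b 1)..}" "s \<le> t"
  define u v where "u = ln s" and "v = ln t"
  have s: "exp (max b 1) \<le> s" "0 < s" using st(1) by (auto intro: less_le_trans[OF exp_gt_zero])
  then have u: "max b 1 \<le> u" unfolding u_def using ln_ge_iff by blast
  have uv: "u \<le> v" unfolding u_def v_def using s st by simp
  have "b * (ln v - ln u) \<le> v - u"
  proof (cases "b \<le> 0")
    case True
    have "ln u \<le> ln v" using u uv by simp
    then have "b * (ln v - ln u) \<le> 0" using True by (intro mult_nonpos_nonneg) auto
    then show ?thesis using uv by simp
  next
    case False
    have "ln v - ln u = ln (v / u)" using u uv by (simp add: ln_div)
    also have "\<dots> \<le> v / u - 1" using u uv by (intro ln_le_minus_one) auto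
    finally have "b * (ln v - ln u) \<le> b * ((v - u) / u)"
      using False u by (intro mult_left_mono) (auto simp: diff_divide_distrib)
    also have "\<dots> = b / u * (v - u)" by simp
    also have "\<dots> \<le> 1 * (v - u)" using u uv by (intro mult_right_mono) auto
    finally show ?thesis by simp
  qed
  then show "ln s - b * ln (ln s) - c \<le> ln t - b * ln (ln t) - c"
    by (simp add: u_def v_def algebra_simps)
qed

text \<open>
  In the three cases \<open>m exp (- l m)\<close> is, to leading order, \<open>b * a powr l * t powr (- b * l) * ln t\<close>,
  \<open>a * ln t powr (1 + b) / t\<close> and \<open>a / (t * ln t)\<close>. The function \<open>G\<close> is a primitive of it up to lower
  order terms, and its increments are computed by asymptotic expansion.
\<close>

theorem corollary5p3:
  fixes P :: "'w measure" and N :: "'w \<Rightarrow> real set" and \<mu> :: "real \<Rightarrow> real" and l :: real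
  assumes "l > 0"
    and "poisson_point_process P N \<mu>"
    and "\<And>t. emeasure (intensity_measure \<mu>) {0<..<t} < \<infinity>"
    and "AE t in lborel. 0 \<le> t \<longrightarrow> 0 < \<mu> t"
  defines "D \<equiv> \<lambda>\<omega>. first_gap l (N \<omega>)"
  shows
    "(\<forall>a b. 0 < b \<and> b < 1 / l \<and> 0 < a \<and> (\<forall>\<^sub>F t in at_top. \<mu> t = b * ln t - ln a) \<longrightarrow>
        (\<lambda>t. measure P {\<omega> \<in> space P. D \<omega> > ereal t}) \<approx>\<^bsub>log\<^esub>
        (\<lambda>t. exp (- (b * a powr l / (1 - b * l) * t powr (1 - b * l) * ln t)))) \<and>
     (\<forall>a b. l = 1 \<and> 0 < a \<and> b > -2 \<and>
          (\<forall>\<^sub>F t in at_top. \<mu> t = ln t - b * ln (ln t) - ln a) \<longrightarrow>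
        (\<lambda>t. measure P {\<omega> \<in> space P. D \<omega> > ereal t}) \<approx>\<^bsub>log\<^esub>
        (\<lambda>t. exp (- (a / (2 + b) * ln t powr (2 + b))))) \<and>
     (\<forall>a. l = 1 \<and> 0 < a \<and> (\<forall>\<^sub>F t in at_top. \<mu> t = ln t + 2 * ln (ln t) - ln a) \<longrightarrow>
        (\<lambda>t. measure P {\<omega> \<in> space P. D \<omega> > ereal t}) \<approx>\<^bsub>log\<^esub>
        (\<lambda>t. ln t powr (- a)))"
proof (intro conjI allI impI)
  interpret poisson_gaps P N \<mu> l by unfold_locales (fact assms)+
  note pos = assms(4)
  {
    fix a b :: real
    assume H: "0 < b \<and> b < 1 / l \<and> 0 < a \<and> (\<forall>\<^sub>F t in at_top. \<mu> t = b * ln t - ln a)"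
    then have bl: "b * l < 1" "0 < b" "0 < a" using l_pos by (auto simp: field_simps)
    define K where "K = b * a powr l / (1 - b * l)"
    have K: "0 \<le> K" using bl by (simp add: K_def)
    interpret slow_intensity P N \<mu> l "\<lambda>t. b * ln t - ln a" "\<lambda>t. K * t powr (1 - b * l) * ln t" 1
    proof unfold_locales
      show "filterlim (\<lambda>t. b * ln t - ln a) at_top at_top" using bl by real_asymp
      show "filterlim (\<lambda>t. K * t powr (1 - b * l) * ln t) at_top at_top"
        unfolding K_def using bl by real_asymp
      show "((\<lambda>t. b * ln (t + c) - ln a - (b * ln t - ln a)) \<longlongrightarrow> 0) at_top" if "0 < c" for c :: real
        using bl that by real_asymp
      show "((\<lambda>t. (K * (t + c) powr (1 - b * l) * ln (t + c) - K * t powr (1 - b * l) * ln t) /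
          (c * (b * ln t - ln a) * exp (- (l * (b * ln t - ln a))))) \<longlongrightarrow> 1) at_top" if "0 < c" for c :: real
        unfolding K_def using bl that l_pos by real_asymp (simp add: powr_def exp_minus field_simps)
      show "mono_on {1..} (\<lambda>t. b * ln t - ln a)"
        using bl by (auto intro!: mono_onI mult_left_mono)
      show "mono_on {1..} (\<lambda>t. K * t powr (1 - b * l) * ln t)"
        using bl K by (auto intro!: mono_onI mult_mono powr_mono2 mult_nonneg_nonneg)
    qed (use pos H in auto)
    show "(\<lambda>t. measure P {\<omega> \<in> space P. D \<omega> > ereal t}) \<approx>\<^bsub>log\<^esub>
        (\<lambda>t. exp (- (b * a powr l / (1 - b * l) * t powr (1 - b * l) * ln t)))"
      unfolding D_def by (rule survive_log_asymp_equiv) (simp add: K_def)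
  next
    fix a b :: real
    assume H: "l = 1 \<and> 0 < a \<and> b > -2 \<and> (\<forall>\<^sub>F t in at_top. \<mu> t = ln t - b * ln (ln t) - ln a)"
    then have l: "l = 1" and ab: "0 < a" "b > -2" by auto
    interpret slow_intensity P N \<mu> l "\<lambda>t. ln t - b * ln (ln t) - ln a" "\<lambda>t. a / (2 + b) * ln t powr (2 + b)" "exp (max b 1)"
    proof unfold_locales
      show "filterlim (\<lambda>t. ln t - b * ln (ln t) - ln a) at_top at_top" by real_asymp
      show "filterlim (\<lambda>t. a / (2 + b) * ln t powr (2 + b)) at_top at_top" using ab by real_asymp
      show "((\<lambda>t. ln (t + c) - b * ln (ln (t + c)) - ln a - (ln t - b * ln (ln t) - ln a)) \<longlongrightarrow> 0) at_top" if "0 < c" for c :: real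
        using that by real_asymp
      show "((\<lambda>t. (a / (2 + b) * ln (t + c) powr (2 + b) - a / (2 + b) * ln t powr (2 + b)) /
          (c * (ln t - b * ln (ln t) - ln a) * exp (- (l * (ln t - b * ln (ln t) - ln a))))) \<longlongrightarrow> 1) at_top" if "0 < c" for c :: real
        unfolding l mult_1 using ab that by real_asymp (simp add: exp_minus field_simps)
      show "mono_on {exp (max b 1)..} (\<lambda>t. ln t - b * ln (ln t) - ln a)"
        by (rule mono_on_log_minus_loglog)
      show "mono_on {exp (max b 1)..} (\<lambda>t. a / (2 + b) * ln t powr (2 + b))"
      proof (rule mono_onI)
        fix s t :: real assume st: "s \<in> {exp (max b 1)..}" "t \<in> {exp (max b 1)..}" "s \<le> t"
        then have "1 \<le> s" by (auto intro: order_trans[of _ "exp (max b 1)"])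
        then show "a / (2 + b) * ln s powr (2 + b) \<le> a / (2 + b) * ln t powr (2 + b)"
          using ab st by (intro mult_left_mono powr_mono2) auto
      qed
    qed (use pos H in auto)
    show "(\<lambda>t. measure P {\<omega> \<in> space P. D \<omega> > ereal t}) \<approx>\<^bsub>log\<^esub>
        (\<lambda>t. exp (- (a / (2 + b) * ln t powr (2 + b))))"
      unfolding D_def by (rule survive_log_asymp_equiv) simp
  next
    fix a :: real
    assume H: "l = 1 \<and> 0 < a \<and> (\<forall>\<^sub>F t in at_top. \<mu> t = ln t + 2 * ln (ln t) - ln a)"
    then have l: "l = 1" and a: "0 < a" by auto
    interpret slow_intensity P N \<mu> l "\<lambda>t. ln t + 2 * ln (ln t) - ln a" "\<lambda>t. a * ln (ln t)" "exp 1"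
    proof unfold_locales
      show "filterlim (\<lambda>t. ln t + 2 * ln (ln t) - ln a) at_top at_top" by real_asymp
      show "filterlim (\<lambda>t. a * ln (ln t)) at_top at_top" using a by real_asymp
      show "((\<lambda>t. ln (t + c) + 2 * ln (ln (t + c)) - ln a - (ln t + 2 * ln (ln t) - ln a)) \<longlongrightarrow> 0) at_top" if "0 < c" for c :: real
        using that by real_asymp
      show "((\<lambda>t. (a * ln (ln (t + c)) - a * ln (ln t)) /
          (c * (ln t + 2 * ln (ln t) - ln a) * exp (- (l * (ln t + 2 * ln (ln t) - ln a))))) \<longlongrightarrow> 1) at_top" if "0 < c" for c :: real
        unfolding l mult_1 using a that by real_asymp (simp add: field_simps)
      show "mono_on {exp 1..} (\<lambda>t. ln t + 2 * ln (ln t) - ln a)"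
        using mono_on_log_minus_loglog[of "-2" "ln a"] by simp
      show "mono_on {exp 1..} (\<lambda>t. a * ln (ln t))"
      proof (rule mono_onI)
        fix s t :: real assume st: "s \<in> {exp 1..}" "t \<in> {exp 1..}" "s \<le> t"
        then have s: "exp 1 \<le> s" "0 < s" by (auto intro: less_le_trans[OF exp_gt_zero])
        then have "1 \<le> ln s" by (simp add: ln_ge_iff)
        moreover have "ln s \<le> ln t" using s st by simp
        ultimately show "a * ln (ln s) \<le> a * ln (ln t)" using a by (intro mult_left_mono) auto
      qed
    qed (use pos H in auto)
    have "\<forall>\<^sub>F t in at_top. 1 < ln (t::real)" by real_asymp
    then have "\<forall>\<^sub>F t in at_top. ln (ln t powr - a) = - (a * ln (ln t))"
      by eventually_elim (simp add: ln_powr)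
    then show "(\<lambda>t. measure P {\<omega> \<in> space P. D \<omega> > ereal t}) \<approx>\<^bsub>log\<^esub> (\<lambda>t. ln t powr (- a))"
      unfolding D_def by (rule survive_log_asymp_equiv)
  }
qed

end
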